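(* Let $\sigma:\mathbb{T}\times\mathbb{Z}\to\mathbb{C}$ be a measurable function such that $\sigma(\cdot,k)\in L^2(\mathbb{T})$ for each $k\in\mathbb{Z}$, and let $T_\sigma$ be its associated pseudo-differential operator. Then $T_\sigma$ defines a bounded linear operator on $L^2(\mathbb{T})$ if and only if the rows of the associated matrix $M_\sigma$ are in $L^2(\mathbb{Z})$, the matrix $(M_\sigma^*M_\sigma)^n$ is defined for all $n\in\mathbb{N}$, and $$\sup_{n\in\mathbb{N}}\sup_{k\in\mathbb{Z}}\Big|\int_{\mathbb{T}}\tau^n(x,k)\,dx\Big|^{1/n}<\infty,$$ where $\tau$ is the symbol of $(T_\sigma)^*T_\sigma=T_{\sigma^*}T_\sigma$ and $\tau^n$ is the symbol of $(T_\tau)^n$. When this happens, $$\sup_{n\in\mathbb{N}}\sup_{k\in\mathbb{Z}}\Big|\int_{\mathbb{T}}\tau^n(x,k)\,dx\Big|^{1/n}=\|T_\sigma\|_{\mathcal{L}(L^2(\mathbb{T}))}^2.$$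
   Context: $\mathbb{T}=\mathbb{R}/2\pi\mathbb{Z}$ with normalized Haar measure $dx$; $\widehat f(k)=\int_{\mathbb{T}}f(x)e^{-ixk}\,dx$; $L^2(\mathbb{Z})$ is $\ell^2(\mathbb{Z})$ (counting measure); $\mathbb{N}=\{1,2,\dots\}$. For $\sigma$ with $\sigma(\cdot,k)\in L^2(\mathbb{T})$ for each $k$, the associated pseudo-differential operator is defined on trigonometric polynomials by $(T_\sigma f)(x)=\sum_{k\in\mathbb{Z}}\sigma(x,k)\widehat f(k)e^{ixk}$; "defines a bounded operator on $L^2(\mathbb{T})$" means that it extends to an element of $\mathcal{L}(L^2(\mathbb{T}))$. The associated matrix of $T_\sigma$ is the infinite matrix with entries $(M_\sigma)_{jk}=\widehat\sigma(j-k,k)=\int_{\mathbb{T}}\sigma(x,k)e^{-ix(j-k)}dx$, $j,k\in\mathbb{Z}$. For infinite matrices $P,Q:\mathbb{Z}\times\mathbb{Z}\to\mathbb{C}$, $(PQ)_{jk}=\sum_{h\in\mathbb{Z}}P_{jh}Q_{hk}$ and $P^*_{jk}=\overline{P_{kj}}$; a product or power is "defined" when all the series giving its entries converge. $\sigma^*$ denotes the symbol whose associated matrix is $M_\sigma^*$; thus $\tau$ is the symbol with associated matrix $M_\sigma^*M_\sigma$, and $\tau^n$ (not a pointwise power) is the symbol with associated matrix $(M_\sigma^*M_\sigma)^n$, so that $\int_{\mathbb{T}}\tau^n(x,k)\,dx=((M_\sigma^*M_\sigma)^n)_{kk}$.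
   Formalization: "(M_σ^*M_σ)^n is defined" is taken to mean that every bracketing of the product converges and all bracketings give the same matrix; with convergence of the recursively formed powers alone the "if" direction is false, since infinite matrix multiplication is not associative. *)

theory Defs
  imports "HOL-Analysis.Analysis"
begin

section \<open>The circle and its square-integrable functions\<close>

text \<open>The circle is represented by its fundamental domain, the half-open interval from
  \<open>0\<close> to \<open>2\<pi>\<close>, with the Lebesgue sigma-algebra and normalized Haar measure.  Everything below sees
  only the values of a function on this interval, so no periodicity needs to be assumed of
  functions \<open>real \<Rightarrow> complex\<close>.\<close>

definition circle :: "real measure" where
  "circle = density (lebesgue_on {0..<2 * pi}) (\<lambda>_. ennreal (1 / (2 * pi)))"

definition L2_functions :: "(real \<Rightarrow> complex) set" where
  "L2_functions =
     {f. f \<in> borel_measurable circle \<and> integrable circle (\<lambda>x. (cmod (f x))\<^sup>2)}"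

definition fourier_coeff :: "(real \<Rightarrow> complex) \<Rightarrow> int \<Rightarrow> complex" where
  "fourier_coeff f k = (\<integral>x. f x * cis (- (x * of_int k)) \<partial>circle)"

definition trig_polynomials :: "(real \<Rightarrow> complex) set" where
  "trig_polynomials =
     {f. \<exists>S c. finite S \<and> f = (\<lambda>x. \<Sum>k\<in>S. c k * cis (x * of_int k))}"


section \<open>The Hilbert space of square-integrable functions modulo null sets\<close>

lemma L2_integrable_prod:
  assumes "f \<in> L2_functions" "g \<in> L2_functions"
  shows "integrable circle (\<lambda>x. f x * cnj (g x))"
proof (rule Bochner_Integration.integrable_bound)
  show "integrable circle (\<lambda>x. (cmod (f x))\<^sup>2 + (cmod (g x))\<^sup>2)"
    using assms by (auto simp: L2_functions_def)
  have "(\<lambda>x. cnj (g x)) \<in> borel_measurable circle"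
    using assms by (intro borel_measurable_continuous_on[where f = cnj] continuous_intros)
      (auto simp: L2_functions_def)
  then show "(\<lambda>x. f x * cnj (g x)) \<in> borel_measurable circle"
    using assms by (auto simp: L2_functions_def)
  have "cmod (f x * cnj (g x)) \<le> norm ((cmod (f x))\<^sup>2 + (cmod (g x))\<^sup>2)" for x
  proof -
    have "0 \<le> (cmod (f x) - cmod (g x))\<^sup>2" "0 \<le> cmod (f x) * cmod (g x)"
      by simp_all
    then have "cmod (f x) * cmod (g x) \<le> (cmod (f x))\<^sup>2 + (cmod (g x))\<^sup>2"
      unfolding power2_diff by linarith
    then show ?thesis
      by (simp add: norm_mult)
  qed
  then show "AE x in circle. cmod (f x * cnj (g x)) \<le> norm ((cmod (f x))\<^sup>2 + (cmod (g x))\<^sup>2)"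
    by simp
qed

lemma L2_add:
  assumes "f \<in> L2_functions" "g \<in> L2_functions"
  shows "(\<lambda>x. f x + g x) \<in> L2_functions"
proof -
  have "integrable circle (\<lambda>x. 2 * (cmod (f x))\<^sup>2 + 2 * (cmod (g x))\<^sup>2)"
    using assms by (auto simp: L2_functions_def)
  then have "integrable circle (\<lambda>x. (cmod (f x + g x))\<^sup>2)"
  proof (rule Bochner_Integration.integrable_bound)
    show "(\<lambda>x. (cmod (f x + g x))\<^sup>2) \<in> borel_measurable circle"
      using assms by (auto simp: L2_functions_def)
    have "norm ((cmod (f x + g x))\<^sup>2) \<le> norm (2 * (cmod (f x))\<^sup>2 + 2 * (cmod (g x))\<^sup>2)" for x
    proof -
      have "(cmod (f x + g x))\<^sup>2 \<le> (cmod (f x) + cmod (g x))\<^sup>2"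
        by (intro power_mono norm_triangle_ineq) simp
      moreover have "0 \<le> (cmod (f x) - cmod (g x))\<^sup>2"
        by simp
      ultimately show ?thesis
        by (simp add: power2_diff power2_sum)
    qed
    then show "AE x in circle. norm ((cmod (f x + g x))\<^sup>2)
        \<le> norm (2 * (cmod (f x))\<^sup>2 + 2 * (cmod (g x))\<^sup>2)"
      by simp
  qed
  then show ?thesis
    using assms by (auto simp: L2_functions_def)
qed

lemma L2_cmult: "f \<in> L2_functions \<Longrightarrow> (\<lambda>x. c * f x) \<in> L2_functions"
  by (auto simp: L2_functions_def norm_mult power_mult_distrib)

lemma L2_zero: "(\<lambda>x. 0) \<in> L2_functions"
  by (auto simp: L2_functions_def)

lemma L2_minus: "f \<in> L2_functions \<Longrightarrow> (\<lambda>x. - f x) \<in> L2_functions"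
  by (auto simp: L2_functions_def)

lemma L2_diff:
  "f \<in> L2_functions \<Longrightarrow> g \<in> L2_functions \<Longrightarrow> (\<lambda>x. f x - g x) \<in> L2_functions"
  using L2_add[OF _ L2_minus, of f g] by simp

lemma L2_scaleR: "f \<in> L2_functions \<Longrightarrow> (\<lambda>x. r *\<^sub>R f x) \<in> L2_functions"
  using L2_cmult[of f "of_real r"] by (simp add: scaleR_conv_of_real)

definition L2_eq :: "(real \<Rightarrow> complex) \<Rightarrow> (real \<Rightarrow> complex) \<Rightarrow> bool" where
  "L2_eq f g \<longleftrightarrow> f \<in> L2_functions \<and> g \<in> L2_functions \<and> (AE x in circle. f x = g x)"

lemma part_equivp_L2_eq: "part_equivp L2_eq"
proof (rule part_equivpI)
  show "\<exists>f. L2_eq f f"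
    using L2_zero by (auto simp: L2_eq_def)
  show "symp L2_eq"
    by (rule sympI) (auto simp: L2_eq_def elim: AE_mp)
  show "transp L2_eq"
    by (rule transpI) (auto simp: L2_eq_def)
qed

quotient_type L2_circle = "real \<Rightarrow> complex" / partial: L2_eq
  morphisms rep_L2 class_L2
  by (rule part_equivp_L2_eq)

lift_definition scaleC_L2 :: "complex \<Rightarrow> L2_circle \<Rightarrow> L2_circle"
  is "\<lambda>c f x. c * f x"
  by (auto simp: L2_eq_def L2_cmult elim: AE_mp)

instantiation L2_circle :: real_inner
begin

lift_definition zero_L2_circle :: L2_circle is "\<lambda>x. 0"
  by (simp add: L2_eq_def L2_zero)

lift_definition plus_L2_circle :: "L2_circle \<Rightarrow> L2_circle \<Rightarrow> L2_circle"
  is "\<lambda>f g x. f x + g x"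
  by (auto simp: L2_eq_def L2_add)

lift_definition minus_L2_circle :: "L2_circle \<Rightarrow> L2_circle \<Rightarrow> L2_circle"
  is "\<lambda>f g x. f x - g x"
  by (auto simp: L2_eq_def L2_diff)

lift_definition uminus_L2_circle :: "L2_circle \<Rightarrow> L2_circle"
  is "\<lambda>f x. - f x"
  by (auto simp: L2_eq_def L2_minus)

lift_definition scaleR_L2_circle :: "real \<Rightarrow> L2_circle \<Rightarrow> L2_circle"
  is "\<lambda>r f x. r *\<^sub>R f x"
  by (auto simp: L2_eq_def L2_scaleR simp del: scaleR_conv_of_real)

text \<open>Isabelle's class of inner product spaces is real; its inner product is the real part of the
  usual complex one and induces the same norm.\<close>

lift_definition inner_L2_circle :: "L2_circle \<Rightarrow> L2_circle \<Rightarrow> real"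
  is "\<lambda>f g. Re (\<integral>x. f x * cnj (g x) \<partial>circle)"
  by (intro arg_cong[where f = Re] integral_cong_AE)
    (auto simp: L2_eq_def intro: borel_measurable_integrable L2_integrable_prod)

lift_definition norm_L2_circle :: "L2_circle \<Rightarrow> real"
  is "\<lambda>f. sqrt (\<integral>x. (cmod (f x))\<^sup>2 \<partial>circle)"
  by (intro arg_cong[where f = sqrt] integral_cong_AE) (auto simp: L2_eq_def L2_functions_def)

definition dist_L2_circle :: "L2_circle \<Rightarrow> L2_circle \<Rightarrow> real" where
  "dist_L2_circle f g = norm (f - g)"

definition sgn_L2_circle :: "L2_circle \<Rightarrow> L2_circle" where
  "sgn_L2_circle f = inverse (norm f) *\<^sub>R f"

definition uniformity_L2_circle :: "(L2_circle \<times> L2_circle) filter" where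
  "uniformity_L2_circle = (INF e\<in>{0 <..}. principal {(f, g). dist f g < e})"

definition open_L2_circle :: "L2_circle set \<Rightarrow> bool" where
  "open_L2_circle U \<longleftrightarrow> (\<forall>f\<in>U. eventually (\<lambda>(f', g). f' = f \<longrightarrow> g \<in> U) uniformity)"

instance
proof
  fix f g h :: L2_circle and r s :: real
  have self: "f x * cnj (f x) = of_real ((cmod (f x))\<^sup>2)" for f :: "real \<Rightarrow> complex" and x
    by (simp add: complex_norm_square del: of_real_power)
  show "f + g + h = f + (g + h)"
    by transfer (simp add: L2_eq_def L2_add add.assoc)
  show "f + g = g + f"
    by transfer (simp add: L2_eq_def L2_add add.commute)
  show "0 + f = f"
    by transfer (simp add: L2_eq_def)
  show "- f + f = 0"
    by transfer (simp add: L2_eq_def L2_zero)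
  show "f - g = f + - g"
    by transfer (simp add: L2_eq_def L2_diff)
  show "r *\<^sub>R (f + g) = r *\<^sub>R f + r *\<^sub>R g"
    by transfer (auto simp: L2_eq_def algebra_simps intro!: L2_scaleR L2_add)
  show "(r + s) *\<^sub>R f = r *\<^sub>R f + s *\<^sub>R f"
    by transfer (auto simp: L2_eq_def algebra_simps intro!: L2_scaleR L2_add)
  show "r *\<^sub>R s *\<^sub>R f = (r * s) *\<^sub>R f"
    by transfer (auto simp: L2_eq_def algebra_simps intro!: L2_scaleR)
  show "1 *\<^sub>R f = f"
    by transfer (auto simp: L2_eq_def)
  show "dist f g = norm (f - g)"
    by (rule dist_L2_circle_def)
  show "sgn f = inverse (norm f) *\<^sub>R f"
    by (rule sgn_L2_circle_def)
  show "(uniformity :: (L2_circle \<times> L2_circle) filter)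
      = (INF e\<in>{0 <..}. principal {(f, g). dist f g < e})"
    by (rule uniformity_L2_circle_def)
  show "open U \<longleftrightarrow> (\<forall>f\<in>U. eventually (\<lambda>(f', g). f' = f \<longrightarrow> g \<in> U) uniformity)"
    for U :: "L2_circle set"
    by (rule open_L2_circle_def)
  show "f \<bullet> g = g \<bullet> f"
  proof transfer
    fix f g
    have "(\<integral>x. g x * cnj (f x) \<partial>circle) = (\<integral>x. cnj (f x * cnj (g x)) \<partial>circle)"
      by (simp add: mult.commute)
    then show "Re (\<integral>x. f x * cnj (g x) \<partial>circle) = Re (\<integral>x. g x * cnj (f x) \<partial>circle)"
      by (simp del: complex_cnj_mult)
  qed
  show "(f + g) \<bullet> h = f \<bullet> h + g \<bullet> h"
    by transfer (simp add: L2_eq_def L2_integrable_prod distrib_right)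
  show "r *\<^sub>R f \<bullet> g = r * (f \<bullet> g)"
    by transfer simp
  have "f \<bullet> f = (norm f)\<^sup>2"
    by transfer (simp add: self del: of_real_power)
  then show "0 \<le> f \<bullet> f" and "norm f = sqrt (f \<bullet> f)"
    by (simp, transfer, simp add: self del: of_real_power)
  show "f \<bullet> f = 0 \<longleftrightarrow> f = 0"
  proof transfer
    fix f assume "L2_eq f f"
    then have *: "integrable circle (\<lambda>x. (cmod (f x))\<^sup>2)" "f \<in> L2_functions"
      by (auto simp: L2_eq_def L2_functions_def)
    have "Re (\<integral>x. f x * cnj (f x) \<partial>circle) = (\<integral>x. (cmod (f x))\<^sup>2 \<partial>circle)"
      by (simp add: self del: of_real_power)
    also have "\<dots> = 0 \<longleftrightarrow> (AE x in circle. f x = 0)"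
      using integral_nonneg_eq_0_iff_AE[OF *(1)] by simp
    finally show "Re (\<integral>x. f x * cnj (f x) \<partial>circle) = 0 \<longleftrightarrow> L2_eq f (\<lambda>x. 0)"
      using *(2) by (simp add: L2_eq_def L2_zero)
  qed
qed

end


section \<open>Infinite matrices\<close>

type_synonym int_matrix = "int \<Rightarrow> int \<Rightarrow> complex"

definition mat_adj :: "int_matrix \<Rightarrow> int_matrix" where
  "mat_adj P j k = cnj (P k j)"

definition mat_mult :: "int_matrix \<Rightarrow> int_matrix \<Rightarrow> int_matrix" where
  "mat_mult P Q j k = (\<Sum>\<^sub>\<infinity>h. P j h * Q h k)"

definition mat_mult_defined :: "int_matrix \<Rightarrow> int_matrix \<Rightarrow> bool" where
  "mat_mult_defined P Q \<longleftrightarrow> (\<forall>j k. (\<lambda>h. P j h * Q h k) summable_on UNIV)"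

fun mat_pow :: "int_matrix \<Rightarrow> nat \<Rightarrow> int_matrix" where
  "mat_pow P 0 = (\<lambda>j k. if j = k then 1 else 0)"
| "mat_pow P (Suc n) = mat_mult (mat_pow P n) P"

text \<open>Multiplication of infinite matrices is not associative, even where all the series involved
  converge absolutely, so a product of \<open>n\<close> factors \<open>P\<close> denotes a matrix only if its value does not
  depend on the bracketing.  The \<open>n\<close>-th power is therefore defined when every way of bracketing
  it consists of convergent series and they all give the same matrix.  By recursion on the
  outermost product, this is the following condition.  (Convergence of the series for one bracketing
  is really weaker: there are infinite matrices \<open>P \<noteq> 0\<close>, with positive semidefinite finite
  sections, for which \<open>P P\<close> is defined and \<open>P (P P) = (P P) P = 0\<close>.)\<close>

definition mat_pow_defined :: "int_matrix \<Rightarrow> nat \<Rightarrow> bool" where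
  "mat_pow_defined P n \<longleftrightarrow>
     (\<forall>i j. 1 \<le> i \<longrightarrow> 1 \<le> j \<longrightarrow> i + j \<le> n \<longrightarrow>
        mat_mult_defined (mat_pow P i) (mat_pow P j) \<and>
        mat_mult (mat_pow P i) (mat_pow P j) = mat_pow P (i + j))"


section \<open>Symbols and pseudo-differential operators\<close>

definition is_symbol :: "(real \<Rightarrow> int \<Rightarrow> complex) \<Rightarrow> bool" where
  "is_symbol \<sigma> \<longleftrightarrow>
     (\<lambda>(x, k). \<sigma> x k) \<in> borel_measurable (circle \<Otimes>\<^sub>M count_space UNIV) \<and>
     (\<forall>k. (\<lambda>x. \<sigma> x k) \<in> L2_functions)"

definition symbol_matrix :: "(real \<Rightarrow> int \<Rightarrow> complex) \<Rightarrow> int_matrix" where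
  "symbol_matrix \<sigma> j k = fourier_coeff (\<lambda>x. \<sigma> x k) (j - k)"

text \<open>The symbol with a given associated matrix, unique up to a null set for each \<open>k\<close>.  It exists
  if and only if the columns of the matrix are square-summable.\<close>

definition matrix_symbol :: "int_matrix \<Rightarrow> real \<Rightarrow> int \<Rightarrow> complex" where
  "matrix_symbol P = (SOME \<tau>. is_symbol \<tau> \<and> symbol_matrix \<tau> = P)"

text \<open>For a trigonometric polynomial \<open>f\<close> the series has only finitely many nonzero terms.\<close>

definition pseudo_diff_op ::
  "(real \<Rightarrow> int \<Rightarrow> complex) \<Rightarrow> (real \<Rightarrow> complex) \<Rightarrow> real \<Rightarrow> complex" where
  "pseudo_diff_op \<sigma> f x = (\<Sum>\<^sub>\<infinity>k. \<sigma> x k * fourier_coeff f k * cis (x * of_int k))"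

text \<open>\<open>bounded_linear\<close> alone means only linearity over the reals.\<close>

definition bounded_extension ::
  "(real \<Rightarrow> int \<Rightarrow> complex) \<Rightarrow> (L2_circle \<Rightarrow> L2_circle) \<Rightarrow> bool" where
  "bounded_extension \<sigma> A \<longleftrightarrow>
     bounded_linear A \<and> (\<forall>c f. A (scaleC_L2 c f) = scaleC_L2 c (A f)) \<and>
     (\<forall>f\<in>trig_polynomials. A (class_L2 f) = class_L2 (pseudo_diff_op \<sigma> f))"

definition gram_matrix :: "(real \<Rightarrow> int \<Rightarrow> complex) \<Rightarrow> int_matrix" where
  "gram_matrix \<sigma> = mat_mult (mat_adj (symbol_matrix \<sigma>)) (symbol_matrix \<sigma>)"

text \<open>The symbol written \<open>\<tau>\<^sup>n\<close>, where \<open>\<tau>\<close> is the symbol of the adjoint of the operator composed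
  with the operator; this is not a pointwise power.\<close>

definition tau_pow :: "(real \<Rightarrow> int \<Rightarrow> complex) \<Rightarrow> nat \<Rightarrow> real \<Rightarrow> int \<Rightarrow> complex" where
  "tau_pow \<sigma> n = matrix_symbol (mat_pow (gram_matrix \<sigma>) n)"

definition tau_sup :: "(real \<Rightarrow> int \<Rightarrow> complex) \<Rightarrow> ereal" where
  "tau_sup \<sigma> =
     (SUP n\<in>{1::nat..}. SUP k::int.
        ereal (cmod (\<integral>x. tau_pow \<sigma> n x k \<partial>circle) powr (1 / real n)))"

end

theory Submission
  imports Defs
begin

text \<open>
Write \<open>M\<close> for the matrix of the symbol and \<open>G = M\<^sup>* M\<close>.  Through Fourier coefficients the space of
square-integrable functions on the circle becomes the space of square-summable sequences, and a
bounded extension of the pseudo-differential operator is the same thing as a bounded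
complex-linear operator whose matrix is \<open>M\<close> (\<open>bounded_extension_iff\<close>).  So the theorem is about
infinite matrices, except that it rests on Parseval's identity and the Riesz-Fischer theorem; the
latter also supplies the symbols \<open>\<tau>\<^sup>n\<close>, whose mean values are the diagonal entries of \<open>G\<^sup>n\<close>.

If the operator \<open>A\<close> is bounded, then \<open>G\<close> is the matrix of \<open>D = A\<^sup>* A\<close>.  The matrix of a
composition of bounded operators is the product of their matrices, with convergent series.  Hence
all bracketings of \<open>G\<^sup>n\<close> converge to the matrix of \<open>D\<^sup>n\<close> because composition is associative, and the
diagonal entries of \<open>G\<^sup>n\<close> are at most \<open>\<parallel>D\<parallel>\<^sup>n \<le> \<parallel>A\<parallel>\<^sup>2\<^sup>n\<close>.  This gives necessity and the inequality
\<open>\<le>\<close> in the norm formula (\<open>bounded_extension_necessary\<close>).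

Conversely, let the diagonal entries of \<open>G\<^sup>n\<close> be at most \<open>C\<^sup>n\<close> in modulus, let \<open>v\<close> be a finitely
supported vector and put \<open>q n = \<langle>G\<^sup>n v, v\<rangle>\<close>.  Since \<open>G\<^sup>n\<close> is Hermitian and \<open>G\<^sup>n G\<^sup>n = G\<^sup>2\<^sup>n\<close>, one has
\<open>q (2n) = \<parallel>G\<^sup>n v\<parallel>\<^sup>2\<close>, and the Cauchy-Schwarz inequality gives \<open>\<bar>q n\<bar>\<^sup>2 \<le> \<parallel>v\<parallel>\<^sup>2 q (2n)\<close>.  Iterating this
along powers of two bounds \<open>q 1\<close> by a \<open>2\<^sup>m\<close>-th root of \<open>q (2\<^sup>m)\<close>, while the Cauchy-Schwarz inequality
for the columns of \<open>G\<^sup>n\<close> bounds every entry of \<open>G\<^sup>2\<^sup>n\<close> by \<open>C\<^sup>2\<^sup>n\<close>, so that \<open>q (2\<^sup>m)\<close> is at most a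
constant depending on \<open>v\<close> times \<open>C\<close> to the power \<open>2\<^sup>m\<close>.  The constant disappears in the limit, and
\<open>\<parallel>M v\<parallel>\<^sup>2 = q 1 \<le> C \<parallel>v\<parallel>\<^sup>2\<close> (\<open>quadratic_form_le_of_diagonal_growth\<close>).  Hence \<open>M\<close> is the matrix of an
operator of norm at most the square root of \<open>C\<close>, which is the only bounded extension.
\<close>

section \<open>Normalized measure on the circle\<close>

lemma space_circle [simp]: "space circle = {0..<2*pi}"
  by (simp add: circle_def space_restrict_space)

lemma sets_circle: "sets circle = sets (lebesgue_on {0..<2*pi})"
  by (simp add: circle_def)

lemma circle_borel_measurable:
  "borel_measurable circle = borel_measurable (lebesgue_on {0..<2*pi})"
  by (rule measurable_cong_sets) (simp_all add: sets_circle)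

lemma emeasure_circle_space: "emeasure circle (space circle) = 1"
proof -
  have "emeasure circle (space circle) = ennreal (1/(2*pi)) * emeasure (lebesgue_on {0..<2*pi}) {0..<2*pi}"
    unfolding space_circle unfolding circle_def
    by (subst emeasure_density) (auto simp: nn_integral_cmult_indicator)
  also have "\<dots> = ennreal (1/(2*pi)) * ennreal (2*pi)"
    by (subst emeasure_restrict_space) auto
  also have "\<dots> = 1"
    by (subst ennreal_mult[symmetric]) auto
  finally show ?thesis .
qed

lemma finite_measure_circle: "finite_measure circle"
  by (rule finite_measureI) (simp only: emeasure_circle_space, simp)

interpretation circle: finite_measure circle
  by (rule finite_measure_circle)

lemma measure_circle_space: "measure circle (space circle) = 1"
  unfolding measure_def emeasure_circle_space by simp

lemma continuous_measurable_circle: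
  fixes f :: "real \<Rightarrow> 'a :: {euclidean_space}"
  assumes "continuous_on UNIV f"
  shows "f \<in> borel_measurable circle"
  unfolding circle_borel_measurable
  by (rule continuous_imp_measurable_on_sets_lebesgue) (auto intro: continuous_on_subset[OF assms])

lemma cis_integer_measurable [measurable]: "(\<lambda>x. cis (x * of_int k)) \<in> borel_measurable circle"
  by (rule continuous_measurable_circle) (intro continuous_intros)

lemma integral_circle_cis:
  "(\<integral>x. cis (x * of_int k) \<partial>circle) = (if k = 0 then 1 else 0)"
proof (cases "k = 0")
  case True
  then show ?thesis using measure_circle_space by simp
next
  case False
  have "(\<integral>x. cis (x * of_int k) \<partial>circle) = (\<integral>x. (1/(2*pi)) *\<^sub>R cis (x * of_int k) \<partial>lebesgue_on {0..<2*pi})"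
    unfolding circle_def
    by (subst integral_density) (auto simp: circle_borel_measurable[symmetric])
  also have "\<dots> = (1/(2*pi)) *\<^sub>R (\<integral>x. cis (x * of_int k) \<partial>lebesgue_on {0..<2*pi})"
    by (rule integral_scaleR_right)
  also have "(\<integral>x. cis (x * of_int k) \<partial>lebesgue_on {0..<2*pi}) = integral {0..<2*pi} (\<lambda>x. cis (x * of_int k))"
  proof (rule lebesgue_integral_eq_integral)
    have "finite_measure (lebesgue_on {0..<2*pi})"
      by (intro finite_measure_lebesgue_on bounded_set_imp_lmeasurable) auto
    then show "integrable (lebesgue_on {0..<2*pi}) (\<lambda>x. cis (x * of_int k))"
      by (rule finite_measure.integrable_const_bound[where B = 1])
        (auto simp: circle_borel_measurable[symmetric])
  qed auto
  also have "\<dots> = integral {0..2*pi} (\<lambda>x. cis (x * of_int k))"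
    proof (rule integral_subset_negligible)
    have "{0..2*pi} - {0..<2*pi} = {2*pi}" by auto
    then show "negligible ({0..2*pi} - {0..<2*pi})" by simp
  qed auto
  also have "\<dots> = 0"
  proof -
    have "((\<lambda>x. cis (x * of_int k)) has_integral 
        cis (2*pi * of_int k) / (\<i> * of_int k) - cis (0 * of_int k) / (\<i> * of_int k)) {0..2*pi}"
      using False
      by (intro fundamental_theorem_of_calculus)
         (auto intro!: derivative_eq_intros has_vector_derivative_real_field simp: cis_conv_exp algebra_simps)
    moreover have "cis (2*pi * of_int k) = 1" by simp
    ultimately show ?thesis by (simp add: integral_unique)
  qed
  finally show ?thesis using False by simp
qed


section \<open>Trigonometric polynomials\<close>

lemma trig_polynomials_cmult:
  assumes "p \<in> trig_polynomials"
  shows "(\<lambda>x. a * p x) \<in> trig_polynomials"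
proof -
  from assms obtain S c where "finite S" "p = (\<lambda>x. \<Sum>k\<in>S. c k * cis (x * of_int k))"
    by (auto simp: trig_polynomials_def)
  then show ?thesis
    unfolding trig_polynomials_def
    by (intro CollectI exI[of _ S] exI[of _ "\<lambda>k. a * c k"]) (auto simp: sum_distrib_left mult.assoc)
qed

lemma trig_polynomials_add:
  assumes "p \<in> trig_polynomials" "q \<in> trig_polynomials"
  shows "(\<lambda>x. p x + q x) \<in> trig_polynomials"
proof -
  from assms(1) obtain S c where S: "finite S" "p = (\<lambda>x. \<Sum>k\<in>S. c k * cis (x * of_int k))"
    by (auto simp: trig_polynomials_def)
  from assms(2) obtain T d where T: "finite T" "q = (\<lambda>x. \<Sum>k\<in>T. d k * cis (x * of_int k))"
    by (auto simp: trig_polynomials_def)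
  let ?c = "\<lambda>k. (if k \<in> S then c k else 0) + (if k \<in> T then d k else 0)"
  have "p x + q x = (\<Sum>k\<in>S \<union> T. ?c k * cis (x * of_int k))" for x
  proof -
    have "p x = (\<Sum>k\<in>S \<union> T. (if k \<in> S then c k else 0) * cis (x * of_int k))"
      unfolding S(2) by (rule sum.mono_neutral_cong_left) (use S T in auto)
    moreover have "q x = (\<Sum>k\<in>S \<union> T. (if k \<in> T then d k else 0) * cis (x * of_int k))"
      unfolding T(2) by (rule sum.mono_neutral_cong_left) (use S T in auto)
    ultimately show ?thesis
      by (simp only: sum.distrib distrib_right)
  qed
  then show ?thesis
    unfolding trig_polynomials_def
    by (intro CollectI exI[of _ "S \<union> T"] exI[of _ ?c]) (use S T in auto)
qed

lemma trig_polynomials_cis: "(\<lambda>x. cis (x * of_int k)) \<in> trig_polynomials"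
  unfolding trig_polynomials_def
  by (intro CollectI exI[of _ "{k}"] exI[of _ "\<lambda>k. 1"]) auto

lemma trig_polynomials_const: "(\<lambda>x. a) \<in> trig_polynomials"
  using trig_polynomials_cmult[OF trig_polynomials_cis[of 0], of a] by simp

lemma trig_polynomials_sum:
  assumes "\<And>i. i \<in> I \<Longrightarrow> p i \<in> trig_polynomials"
  shows "(\<lambda>x. \<Sum>i\<in>I. p i x) \<in> trig_polynomials"
  using assms
  by (induction I rule: infinite_finite_induct)
    (auto intro: trig_polynomials_const trig_polynomials_add)

lemma trig_polynomials_mult:
  assumes "p \<in> trig_polynomials" "q \<in> trig_polynomials"
  shows "(\<lambda>x. p x * q x) \<in> trig_polynomials"
proof -
  from assms(1) obtain S c where S: "finite S" "p = (\<lambda>x. \<Sum>k\<in>S. c k * cis (x * of_int k))"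
    by (auto simp: trig_polynomials_def)
  from assms(2) obtain T d where T: "finite T" "q = (\<lambda>x. \<Sum>k\<in>T. d k * cis (x * of_int k))"
    by (auto simp: trig_polynomials_def)
  have "(\<lambda>x. p x * q x) = (\<lambda>x. \<Sum>k\<in>S. \<Sum>l\<in>T. (c k * d l) * cis (x * of_int (k + l)))"
    unfolding S(2) T(2) sum_product
    by (intro ext sum.cong) (auto simp: cis_mult[symmetric] algebra_simps)
  then show ?thesis
    by (auto intro!: trig_polynomials_sum trig_polynomials_cmult trig_polynomials_cis simp del: of_int_add)
qed

text \<open>On the unit circle a real-linear functional of \<open>z = cis x\<close> is a combination of \<open>cos x\<close> and
  \<open>sin x\<close>, hence of \<open>cis x\<close> and \<open>cis (- x)\<close>.  This turns polynomial approximation in the plane, for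
  which the Stone-Weierstrass theorem is available, into trigonometric approximation.\<close>

lemma real_polynomial_on_circle_trig_polynomial:
  assumes "real_polynomial_function (g :: complex \<Rightarrow> real)"
  shows "(\<lambda>x. complex_of_real (g (cis x))) \<in> trig_polynomials"
  using assms
proof induction
  case (linear h)
  interpret h: bounded_linear h by fact
  have "complex_of_real (h (cis x)) =
      of_real (h 1) * ((1/2) * cis (x * of_int 1) + (1/2) * cis (x * of_int (-1)))
    + of_real (h \<i>) * ((-\<i>/2) * cis (x * of_int 1) + (\<i>/2) * cis (x * of_int (-1)))" for x
  proof -
    have "cis x = cos x *\<^sub>R 1 + sin x *\<^sub>R \<i>"
      by (simp add: complex_eq_iff)
    then have "h (cis x) = cos x * h 1 + sin x * h \<i>"
      by (simp only: h.add h.scaleR) simp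
    then show ?thesis
      by (simp add: complex_eq_iff)
  qed
  then show ?case
    by (simp only:) (intro trig_polynomials_add trig_polynomials_cmult trig_polynomials_cis)
next
  case (const c)
  show ?case by (rule trig_polynomials_const)
next
  case (add f g)
  then show ?case using trig_polynomials_add by simp
next
  case (mult f g)
  then show ?case using trig_polynomials_mult by simp
qed

lemma trig_polynomial_bounded_measurable:
  assumes "p \<in> trig_polynomials"
  shows "p \<in> borel_measurable circle" "\<exists>B. \<forall>x. cmod (p x) \<le> B"
proof -
  from assms obtain S c where S: "finite S" "p = (\<lambda>x. \<Sum>k\<in>S. c k * cis (x * of_int k))"
    by (auto simp: trig_polynomials_def)
  show "p \<in> borel_measurable circle"
    unfolding S(2) by measurable
  have "cmod (p x) \<le> (\<Sum>k\<in>S. cmod (c k))" for x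
    unfolding S(2) by (rule order.trans[OF norm_sum]) (simp add: norm_mult)
  then show "\<exists>B. \<forall>x. cmod (p x) \<le> B" by blast
qed

lemma integrable_mult_bounded:
  fixes f g :: "real \<Rightarrow> complex"
  assumes "integrable circle f" "g \<in> borel_measurable circle" "\<And>x. cmod (g x) \<le> B"
  shows "integrable circle (\<lambda>x. f x * g x)"
proof (rule Bochner_Integration.integrable_bound)
  show "integrable circle (\<lambda>x. B * cmod (f x))"
    using assms by auto
  show "(\<lambda>x. f x * g x) \<in> borel_measurable circle"
    using assms by auto
  show "AE x in circle. cmod (f x * g x) \<le> norm (B * cmod (f x))"
  proof (rule AE_I2)
    fix x
    have "cmod (f x) * cmod (g x) \<le> cmod (f x) * B"
      by (intro mult_left_mono assms) auto
    then show "cmod (f x * g x) \<le> norm (B * cmod (f x))"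
      by (simp add: norm_mult abs_mult mult.commute) (smt (verit) mult_right_mono norm_ge_zero)
  qed
qed

lemma integrable_trig_polynomial_mult:
  assumes "integrable circle f" "p \<in> trig_polynomials"
  shows "integrable circle (\<lambda>x. f x * p x)"
  using trig_polynomial_bounded_measurable[OF assms(2)] integrable_mult_bounded[OF assms(1)] by blast

lemma fourier_coeff_zero_trig:
  assumes f: "integrable circle f" and zero: "\<And>k. fourier_coeff f k = 0"
    and p: "p \<in> trig_polynomials"
  shows "(\<integral>x. f x * p x \<partial>circle) = 0"
proof -
  from p obtain S c where S: "finite S" "p = (\<lambda>x. \<Sum>k\<in>S. c k * cis (x * of_int k))"
    by (auto simp: trig_polynomials_def)
  have int: "integrable circle (\<lambda>x. f x * (c k * cis (x * of_int k)))" for k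
    by (intro integrable_trig_polynomial_mult f trig_polynomials_cmult trig_polynomials_cis)
  have "(\<integral>x. f x * p x \<partial>circle) = (\<Sum>k\<in>S. \<integral>x. f x * (c k * cis (x * of_int k)) \<partial>circle)"
    unfolding S(2) sum_distrib_left by (rule Bochner_Integration.integral_sum) (rule int)
  also have "\<dots> = (\<Sum>k\<in>S. c k * fourier_coeff f (- k))"
    by (intro sum.cong refl)
      (simp add: fourier_coeff_def mult.left_commute flip: integral_mult_right_zero)
  finally show ?thesis using zero by simp
qed

text \<open>First step towards uniqueness of Fourier coefficients: orthogonality to all trigonometric
  polynomials passes to their uniform limits.\<close>

lemma fourier_coeff_zero_continuous:
  fixes \<phi> :: "complex \<Rightarrow> real"
  assumes f: "integrable circle f" and zero: "\<And>k. fourier_coeff f k = 0"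
    and \<phi>: "continuous_on UNIV \<phi>"
  shows "(\<integral>x. f x * of_real (\<phi> (cis x)) \<partial>circle) = 0"
proof -
  have cont: "continuous_on UNIV (\<lambda>x. complex_of_real (\<phi> (cis x)))"
    by (intro continuous_intros continuous_on_compose2[OF \<phi>]) auto
  have "compact (\<phi> ` sphere 0 1)"
    by (intro compact_continuous_image continuous_on_subset[OF \<phi>]) auto
  then obtain B where B: "\<And>z. z \<in> sphere 0 1 \<Longrightarrow> \<bar>\<phi> z\<bar> \<le> B"
    using compact_imp_bounded bounded_iff by (metis image_eqI real_norm_def)
  have int: "integrable circle (\<lambda>x. f x * of_real (\<phi> (cis x)))"
    by (rule integrable_mult_bounded[where B = B, OF f continuous_measurable_circle[OF cont]])
       (use B in auto)
  have "cmod (\<integral>x. f x * of_real (\<phi> (cis x)) \<partial>circle) \<le> e * (\<integral>x. cmod (f x) \<partial>circle)"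
    if "e > 0" for e
  proof -
    obtain g where g: "real_polynomial_function g" "\<And>z. z \<in> sphere 0 1 \<Longrightarrow> \<bar>\<phi> z - g z\<bar> < e"
      using Stone_Weierstrass_real_polynomial_function[OF compact_sphere
          continuous_on_subset[OF \<phi> subset_UNIV] \<open>e > 0\<close>] by metis
    let ?p = "\<lambda>x. complex_of_real (g (cis x))"
    have p: "?p \<in> trig_polynomials"
      by (rule real_polynomial_on_circle_trig_polynomial) fact
    have intp: "integrable circle (\<lambda>x. f x * ?p x)"
      by (rule integrable_trig_polynomial_mult) fact+
    have "(\<integral>x. f x * of_real (\<phi> (cis x)) \<partial>circle)
        = (\<integral>x. f x * of_real (\<phi> (cis x)) \<partial>circle) - (\<integral>x. f x * ?p x \<partial>circle)"
      using fourier_coeff_zero_trig[OF f zero p] by simp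
    also have "\<dots> = (\<integral>x. f x * of_real (\<phi> (cis x)) - f x * ?p x \<partial>circle)"
      by (rule Bochner_Integration.integral_diff[symmetric]) fact+
    also have "cmod \<dots> \<le> (\<integral>x. e * cmod (f x) \<partial>circle)"
    proof (rule Bochner_Integration.integral_norm_bound_integral)
      show "integrable circle (\<lambda>x. f x * of_real (\<phi> (cis x)) - f x * ?p x)"
        using int intp by (rule Bochner_Integration.integrable_diff)
      show "integrable circle (\<lambda>x. e * cmod (f x))"
        using f by auto
      fix x
      have "cmod (f x * of_real (\<phi> (cis x)) - f x * ?p x) = cmod (f x) * \<bar>\<phi> (cis x) - g (cis x)\<bar>"
        by (simp only: right_diff_distrib[symmetric] of_real_diff[symmetric] norm_mult norm_of_real)
      also have "\<dots> \<le> cmod (f x) * e"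
        using g(2)[of "cis x"] by (intro mult_left_mono) auto
      finally show "cmod (f x * of_real (\<phi> (cis x)) - f x * ?p x) \<le> e * cmod (f x)"
        by (simp add: mult.commute)
    qed
    finally show ?thesis by simp
  qed
  then have "cmod (\<integral>x. f x * of_real (\<phi> (cis x)) \<partial>circle) \<le> 0"
  proof -
    let ?I = "\<integral>x. cmod (f x) \<partial>circle"
    assume *: "\<And>e. e > 0 \<Longrightarrow> cmod (\<integral>x. f x * of_real (\<phi> (cis x)) \<partial>circle) \<le> e * ?I"
    have "?I \<ge> 0" by simp
    show ?thesis
    proof (rule field_le_epsilon)
      fix e :: real assume "e > 0"
      \<comment> \<open>The summand \<open>1\<close> covers the case of a vanishing integral \<open>?I\<close>.\<close>
      then have "cmod (\<integral>x. f x * of_real (\<phi> (cis x)) \<partial>circle) \<le> e / (?I + 1) * ?I"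
        using \<open>?I \<ge> 0\<close> by (intro *) (simp add: add_nonneg_pos)
      also have "\<dots> \<le> e" 
      proof -
        have "?I + 1 > 0" using \<open>?I \<ge> 0\<close> by linarith
        then show ?thesis using \<open>e > 0\<close> by (simp add: divide_le_eq distrib_left)
      qed
      finally show "cmod (\<integral>x. f x * of_real (\<phi> (cis x)) \<partial>circle) \<le> 0 + e" by simp
    qed
  qed
  then show ?thesis by simp
qed

section \<open>Uniqueness of Fourier coefficients\<close>

lemma emeasure_circle:
  assumes "B \<in> sets circle"
  shows "emeasure circle B = ennreal (1 / (2*pi)) * emeasure lebesgue B"
proof -
  have "emeasure circle B = (\<integral>\<^sup>+x. ennreal (1/(2*pi)) * indicator B x \<partial>lebesgue_on {0..<2*pi})"
    using assms unfolding circle_def by (subst emeasure_density) (auto simp: sets_circle)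
  also have "\<dots> = ennreal (1/(2*pi)) * emeasure (lebesgue_on {0..<2*pi}) B"
    using assms by (subst nn_integral_cmult_indicator) (auto simp: sets_circle)
  also have "emeasure (lebesgue_on {0..<2*pi}) B = emeasure lebesgue B"
    using assms by (subst emeasure_restrict_space) (auto simp: sets_circle sets_restrict_space)
  finally show ?thesis .
qed

lemma circle_sets_iff: "B \<in> sets circle \<longleftrightarrow> B \<in> sets lebesgue \<and> B \<subseteq> {0..<2*pi}"
  unfolding sets_circle by (subst sets_restrict_space_iff) auto

lemma emeasure_circle_le:
  assumes "B \<in> sets circle"
  shows "emeasure circle B \<le> emeasure lebesgue B"
proof -
  have "(1::real) \<le> 2 * pi" using pi_gt3 by linarith
  then have "ennreal (1 / (2*pi)) \<le> 1"
    by (simp add: field_simps)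
  then have "ennreal (1 / (2*pi)) * emeasure lebesgue B \<le> 1 * emeasure lebesgue B"
    by (rule mult_right_mono) simp
  then show ?thesis
    using emeasure_circle[OF assms] by simp
qed

lemma AE_circle_nonzero: "AE x in circle. x \<noteq> 0"
proof (rule AE_I)
  have "{0} \<in> sets circle" by (simp add: circle_sets_iff)
  then show "emeasure circle {0} = 0" "{0} \<in> sets circle"
    by (simp_all add: emeasure_circle)
qed auto

lemma Arg2pi_cis: "0 \<le> x \<Longrightarrow> x < 2 * pi \<Longrightarrow> Arg2pi (cis x) = x"
  using Arg2pi_exp[of "\<i> * of_real x"] by (simp add: cis_conv_exp)

lemma indicator_measurable_circle:
  assumes "B \<in> sets lebesgue"
  shows "(indicator B :: real \<Rightarrow> complex) \<in> borel_measurable circle"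
  using assms unfolding borel_measurable_indicator_iff circle_sets_iff by auto

lemma open_indicator_measurable_circle:
  assumes "open V"
  shows "(indicator V :: real \<Rightarrow> complex) \<in> borel_measurable circle"
proof (rule indicator_measurable_circle)
  have "V \<in> sets lborel" using assms by simp
  then show "V \<in> sets lebesgue" by (rule sets_completionI_sets)
qed

text \<open>The indicator function of an open set of angles becomes, up to the angle \<open>0\<close>, the indicator
  function of an open set \<open>U\<close> of the plane cut along the nonnegative reals.  The latter is a bounded
  pointwise limit of continuous functions of the distance to the complement of \<open>U\<close>, so that
  dominated convergence applies.\<close>

lemma fourier_coeff_zero_open:
  assumes f: "integrable circle f" and zero: "\<And>k. fourier_coeff f k = 0"
    and V: "open V"
  shows "(\<integral>x. f x * indicator V x \<partial>circle) = 0"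
proof -
  define U :: "complex set" where "U = (UNIV - \<real>\<^sub>\<ge>\<^sub>0) \<inter> Arg2pi -` V"
  have "continuous_on (UNIV - \<real>\<^sub>\<ge>\<^sub>0) Arg2pi"
    using continuous_at_Arg2pi continuous_at_imp_continuous_within
    by (auto simp: continuous_on_eq_continuous_within)
  moreover have "open (UNIV - \<real>\<^sub>\<ge>\<^sub>0 :: complex set)"
    by (simp add: open_Diff)
  ultimately have "open U"
    unfolding U_def using V continuous_open_preimage by blast
  then have cl: "closed (- U)" by (rule closed_Compl)
  have "0 \<in> - U" by (simp add: U_def)
  then have ne: "- U \<noteq> {}" by fast
  define \<phi> where "\<phi> n z = min 1 (real n * infdist z (- U))" for n z
  have \<phi>: "continuous_on UNIV (\<phi> n)" for n
    unfolding \<phi>_def by (intro continuous_intros)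
  have \<phi>_bound: "0 \<le> \<phi> n z" "\<phi> n z \<le> 1" for n z
    by (auto simp: \<phi>_def infdist_nonneg)
  have meas: "(\<lambda>x. complex_of_real (\<phi> n (cis x))) \<in> borel_measurable circle" for n
    by (intro continuous_measurable_circle continuous_intros continuous_on_compose2[OF \<phi>]) auto
  have lim: "(\<lambda>n. \<phi> n z) \<longlonglongrightarrow> indicator U z" for z
  proof (cases "z \<in> U")
    case True
    then have pos: "infdist z (- U) > 0"
      using infdist_pos_not_in_closed[OF cl ne] by auto
    then obtain N where N: "1 < real N * infdist z (- U)"
      using reals_Archimedean3 by blast
    have "\<phi> n z = 1" if "n \<ge> N" for n
    proof -
      have "real N * infdist z (- U) \<le> real n * infdist z (- U)"
        using that pos by (intro mult_right_mono) auto
      then show ?thesis using N by (simp add: \<phi>_def)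
    qed
    then have "eventually (\<lambda>n. \<phi> n z = 1) sequentially"
      by (auto simp: eventually_sequentially)
    then show ?thesis using True by (simp add: tendsto_eventually)
  next
    case False
    then have "infdist z (- U) = 0" by simp
    then show ?thesis using False by (simp add: \<phi>_def)
  qed
  have "(\<lambda>n. \<integral>x. f x * of_real (\<phi> n (cis x)) \<partial>circle) \<longlonglongrightarrow> (\<integral>x. f x * indicator V x \<partial>circle)"
  proof (rule integral_dominated_convergence[where w = "\<lambda>x. cmod (f x)"])
    show "(\<lambda>x. f x * indicator V x) \<in> borel_measurable circle"
      by (intro borel_measurable_times borel_measurable_integrable[OF f] open_indicator_measurable_circle V)
    show "(\<lambda>x. f x * of_real (\<phi> n (cis x))) \<in> borel_measurable circle" for n
      using f meas[of n] by auto
    show "integrable circle (\<lambda>x. cmod (f x))" using f by auto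
    show "AE x in circle. cmod (f x * of_real (\<phi> n (cis x))) \<le> cmod (f x)" for n
      using \<phi>_bound[of n] by (intro AE_I2) (simp add: norm_mult mult_left_le)
    show "AE x in circle. (\<lambda>n. f x * of_real (\<phi> n (cis x))) \<longlonglongrightarrow> f x * indicator V x"
      using AE_circle_nonzero AE_space
    proof eventually_elim
      case (elim x)
      then have arg: "Arg2pi (cis x) = x" by (simp add: Arg2pi_cis)
      then have "cis x \<notin> \<real>\<^sub>\<ge>\<^sub>0"
        using elim Arg2pi_eq_0[of "cis x"] by (auto simp: complex_nonneg_Reals_iff complex_is_Real_iff)
      then have "indicator V x = complex_of_real (indicator U (cis x))"
        using arg by (auto simp: U_def indicator_def)
      then show ?case
        using lim[of "cis x"] by (simp only:) (intro tendsto_intros)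
    qed
  qed
  moreover have "(\<integral>x. f x * of_real (\<phi> n (cis x)) \<partial>circle) = 0" for n
    by (rule fourier_coeff_zero_continuous[OF f zero \<phi>])
  ultimately show ?thesis
    by (simp only: LIMSEQ_const_iff)
qed

text \<open>It suffices that \<open>f\<close> has integral zero over every measurable set \<open>A\<close>.  For open sets this is
  known, and \<open>A\<close> has open supersets that exceed it by sets of measure less than \<open>2\<^sup>-\<^sup>n\<close>; by the
  Borel-Cantelli lemma their indicator functions converge to that of \<open>A\<close> almost everywhere.\<close>

theorem fourier_coeff_zero_imp_AE_zero:
  assumes f: "integrable circle f" and zero: "\<And>k. fourier_coeff f k = 0"
  shows "AE x in circle. f x = 0"
proof (rule circle.density_zero[OF f])
  fix A assume A: "A \<in> sets circle"
  then have leb: "A \<in> sets lebesgue" and sub: "A \<subseteq> {0..<2*pi}"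
    by (auto simp: circle_sets_iff)
  have "\<exists>T. open T \<and> A \<subseteq> T \<and> T - A \<in> lmeasurable \<and> emeasure lebesgue (T - A) < ennreal ((1/2)^n)" for n
    using sets_lebesgue_outer_open[OF leb, of "(1/2)^n"] by force
  then obtain T where T: "\<And>n. open (T n)" "\<And>n. A \<subseteq> T n" "\<And>n. T n - A \<in> lmeasurable"
      "\<And>n. emeasure lebesgue (T n - A) < ennreal ((1/2)^n)"
    by metis
  \<comment> \<open>The measure on the circle lives on the fundamental domain, so the excess is cut down to it.\<close>
  define D where "D n = (T n - A) \<inter> {0..<2*pi}" for n
  have D: "D n \<in> sets circle" for n
    using T(3)[of n] by (auto simp: D_def circle_sets_iff fmeasurableD)
  have D_small: "emeasure circle (D n) \<le> ennreal ((1/2)^n)" for n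
  proof -
    have "emeasure circle (D n) \<le> emeasure lebesgue (D n)"
      by (rule emeasure_circle_le[OF D])
    also have "\<dots> \<le> emeasure lebesgue (T n - A)"
      by (rule emeasure_mono) (use T(3)[of n] in \<open>auto simp: D_def fmeasurableD\<close>)
    finally show ?thesis using T(4)[of n] by simp
  qed
  have "AE x in circle. eventually (\<lambda>n. x \<in> space circle - D n) sequentially"
  proof (rule borel_cantelli_AE1[OF D])
    show "emeasure circle (D n) < \<infinity>" for n
      by (simp add: circle.emeasure_eq_measure)
    have "measure circle (D n) \<le> (1/2)^n" for n
      using D_small[of n] by (simp add: circle.emeasure_eq_measure)
    then show "summable (\<lambda>n. measure circle (D n))"
      by (intro summable_comparison_test'[OF summable_geometric[of "1/2 :: real"]]) auto
  qed
  then have ev: "AE x in circle. (\<lambda>n. f x * indicator (T n) x) \<longlonglongrightarrow> f x * indicator A x"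
    using AE_space
  proof eventually_elim
    case (elim x)
    have "eventually (\<lambda>n. f x * indicator (T n) x = f x * indicator A x) sequentially"
      using elim(1)
    proof eventually_elim
      case (elim n)
      then show ?case
        using T(2)[of n] by (auto simp: D_def indicator_def)
    qed
    then show ?case by (rule tendsto_eventually)
  qed
  have "(\<lambda>n. \<integral>x. f x * indicator (T n) x \<partial>circle) \<longlonglongrightarrow> (\<integral>x. f x * indicator A x \<partial>circle)"
  proof (rule integral_dominated_convergence[where w = "\<lambda>x. cmod (f x)"])
    show "(\<lambda>x. f x * indicator A x) \<in> borel_measurable circle"
      by (intro borel_measurable_times borel_measurable_integrable[OF f] indicator_measurable_circle leb)
    show "(\<lambda>x. f x * indicator (T n) x) \<in> borel_measurable circle" for n
      by (intro borel_measurable_times borel_measurable_integrable[OF f] open_indicator_measurable_circle T(1))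
    show "integrable circle (\<lambda>x. cmod (f x))" using f by auto
    show "AE x in circle. cmod (f x * indicator (T n) x) \<le> cmod (f x)" for n
      by (intro AE_I2) (auto simp: norm_mult indicator_def)
  qed (rule ev)
  moreover have "(\<integral>x. f x * indicator (T n) x \<partial>circle) = 0" for n
    by (rule fourier_coeff_zero_open[OF f zero T(1)])
  ultimately have "(\<integral>x. f x * indicator A x \<partial>circle) = 0"
    by (simp only: LIMSEQ_const_iff)
  moreover have "set_lebesgue_integral circle A f = (\<integral>x. f x * indicator A x \<partial>circle)"
    unfolding set_lebesgue_integral_def
    by (rule Bochner_Integration.integral_cong) (auto simp: indicator_def)
  ultimately show "set_lebesgue_integral circle A f = 0" by simp
qed

section \<open>The Riesz-Fischer theorem\<close>

lemma cnj_cis_integer: "cnj (cis (x * of_int k)) = cis (- (x * of_int k))"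
  by (simp add: cis_cnj)

lemma trig_polynomial_sum:
  "finite S \<Longrightarrow> (\<lambda>x. \<Sum>k\<in>S. c k * cis (x * of_int k)) \<in> trig_polynomials"
  by (auto simp: trig_polynomials_def)

lemma trig_polynomial_integrable:
  assumes "p \<in> trig_polynomials"
  shows "integrable circle p"
  using integrable_trig_polynomial_mult[of "\<lambda>_. 1", OF _ assms] by simp

lemma trig_polynomial_L2:
  assumes "p \<in> trig_polynomials"
  shows "p \<in> L2_functions"
proof -
  obtain B where B: "\<And>x. cmod (p x) \<le> B" and [measurable]: "p \<in> borel_measurable circle"
    using trig_polynomial_bounded_measurable[OF assms] by blast
  have "integrable circle (\<lambda>x. (cmod (p x))\<^sup>2)"
    by (rule circle.integrable_const_bound[where B = "B\<^sup>2"])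
      (auto intro!: AE_I2 power_mono B)
  then show ?thesis by (simp add: L2_functions_def)
qed

lemma fourier_coeff_trig_polynomial:
  assumes "finite S"
  shows "fourier_coeff (\<lambda>x. \<Sum>k\<in>S. c k * cis (x * of_int k)) j = (if j \<in> S then c j else 0)"
proof -
  have int: "integrable circle (\<lambda>x. c k * cis (x * of_int (k - j)))" for k
    by (intro trig_polynomial_integrable trig_polynomials_cmult trig_polynomials_cis)
  have "fourier_coeff (\<lambda>x. \<Sum>k\<in>S. c k * cis (x * of_int k)) j
      = (\<integral>x. (\<Sum>k\<in>S. c k * cis (x * of_int (k - j))) \<partial>circle)"
    unfolding fourier_coeff_def sum_distrib_right
    by (intro Bochner_Integration.integral_cong sum.cong refl)
      (simp add: mult.assoc cis_mult algebra_simps)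
  also have "\<dots> = (\<Sum>k\<in>S. \<integral>x. c k * cis (x * of_int (k - j)) \<partial>circle)"
    by (rule Bochner_Integration.integral_sum) (rule int)
  also have "\<dots> = (\<Sum>k\<in>S. c k * (if k - j = 0 then 1 else 0))"
    unfolding integral_mult_right_zero integral_circle_cis ..
  also have "\<dots> = (if j \<in> S then c j else 0)"
    using assms by (simp add: if_distrib[of "\<lambda>x. _ * x"] cong: if_cong)
  finally show ?thesis .
qed

lemma integral_norm_square_trig_polynomial:
  assumes "finite S"
  shows "(\<integral>x. (cmod (\<Sum>k\<in>S. c k * cis (x * of_int k)))\<^sup>2 \<partial>circle) = (\<Sum>k\<in>S. (cmod (c k))\<^sup>2)"
proof -
  let ?p = "\<lambda>x. \<Sum>k\<in>S. c k * cis (x * of_int k)"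
  have int: "integrable circle (\<lambda>x. ?p x * cis (- (x * of_int k)))" for k
    using integrable_trig_polynomial_mult[OF trig_polynomial_integrable[OF trig_polynomial_sum[OF assms]]
       trig_polynomials_cis[of "- k"]] by simp
  have "complex_of_real (\<integral>x. (cmod (?p x))\<^sup>2 \<partial>circle) = (\<integral>x. ?p x * cnj (?p x) \<partial>circle)"
    unfolding integral_complex_of_real[symmetric]
    by (intro Bochner_Integration.integral_cong refl) (simp add: complex_norm_square del: of_real_power)
  also have "\<dots> = (\<integral>x. (\<Sum>k\<in>S. cnj (c k) * (?p x * cis (- (x * of_int k)))) \<partial>circle)"
    by (intro Bochner_Integration.integral_cong refl)
      (simp only: cnj_sum complex_cnj_mult cnj_cis_integer sum_distrib_left mult.left_commute)
  also have "\<dots> = (\<Sum>k\<in>S. \<integral>x. cnj (c k) * (?p x * cis (- (x * of_int k))) \<partial>circle)"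
    by (rule Bochner_Integration.integral_sum) (intro integrable_mult_right int)
  also have "\<dots> = (\<Sum>k\<in>S. cnj (c k) * fourier_coeff ?p k)"
    unfolding integral_mult_right_zero fourier_coeff_def ..
  also have "\<dots> = (\<Sum>k\<in>S. cnj (c k) * c k)"
    unfolding fourier_coeff_trig_polynomial[OF assms] by (intro sum.cong) auto
  also have "\<dots> = complex_of_real (\<Sum>k\<in>S. (cmod (c k))\<^sup>2)"
    unfolding of_real_sum by (intro sum.cong refl) (metis complex_norm_square mult.commute)
  finally show ?thesis
    by (simp only: of_real_eq_iff)
qed

lemma L2_integrable:
  assumes "f \<in> L2_functions"
  shows "integrable circle f"
  using L2_integrable_prod[OF assms trig_polynomial_L2[OF trig_polynomials_const[of 1]]] by simp

lemma L2_integrable_cis: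
  assumes "f \<in> L2_functions"
  shows "integrable circle (\<lambda>x. f x * cis (- (x * of_int k)))"
  using integrable_trig_polynomial_mult[OF L2_integrable[OF assms] trig_polynomials_cis[of "- k"]]
  by simp

text \<open>The total mass is one, so the mean of \<open>\<bar>g\<bar>\<close> is at most the root of the mean of \<open>\<bar>g\<bar>\<^sup>2\<close>.  It
  follows by integrating \<open>2 t \<bar>g\<bar> \<le> t\<^sup>2 + \<bar>g\<bar>\<^sup>2\<close>.\<close>

lemma integral_norm_le_of_square:
  assumes g: "g \<in> L2_functions" and le: "(\<integral>x. (cmod (g x))\<^sup>2 \<partial>circle) \<le> t\<^sup>2" and "t > 0"
  shows "(\<integral>x. cmod (g x) \<partial>circle) \<le> t"
proof -
  have sq: "integrable circle (\<lambda>x. (cmod (g x))\<^sup>2)"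
    using g by (simp add: L2_functions_def)
  have "(\<integral>x. cmod (g x) \<partial>circle) \<le> (\<integral>x. t / 2 + (1 / (2 * t)) * (cmod (g x))\<^sup>2 \<partial>circle)"
  proof (rule integral_mono)
    show "integrable circle (\<lambda>x. cmod (g x))"
      using L2_integrable[OF g] by simp
    show "integrable circle (\<lambda>x. t / 2 + (1 / (2 * t)) * (cmod (g x))\<^sup>2)"
      using sq by auto
    fix x
    have "0 \<le> (t - cmod (g x))\<^sup>2" by simp
    then have "2 * t * cmod (g x) \<le> t\<^sup>2 + (cmod (g x))\<^sup>2"
      by (simp add: power2_diff)
    then show "cmod (g x) \<le> t / 2 + (1 / (2 * t)) * (cmod (g x))\<^sup>2"
      using \<open>t > 0\<close> by (simp add: field_simps power2_eq_square)
  qed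
  also have "\<dots> = t / 2 + (1 / (2 * t)) * (\<integral>x. (cmod (g x))\<^sup>2 \<partial>circle)"
    using sq measure_circle_space by (subst Bochner_Integration.integral_add) auto
  also have "\<dots> \<le> t / 2 + (1 / (2 * t)) * t\<^sup>2"
    using le \<open>t > 0\<close> by (intro add_left_mono mult_left_mono) auto
  also have "\<dots> = t"
    using \<open>t > 0\<close> by (simp add: power2_eq_square)
  finally show ?thesis .
qed

text \<open>Passing to the limit along a fast enough exhaustion makes the increments of the partial sums as
  small as desired; this is the subsequence behind the almost everywhere convergence in the
  Riesz-Fischer theorem.\<close>

lemma finite_exhaustion_with_small_increments:
  fixes a :: "int \<Rightarrow> real"
  assumes a: "a summable_on UNIV" "\<And>k. a k \<ge> 0" and e: "\<And>i. e i > 0"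
  obtains F :: "nat \<Rightarrow> int set" where
    "\<And>i. finite (F i)" "\<And>i. F i \<subseteq> F (Suc i)" "\<And>k. \<exists>n. \<forall>i\<ge>n. k \<in> F i"
    "\<And>i. sum a (F (Suc i) - F i) \<le> e i"
proof -
  have hs: "(a has_sum infsum a UNIV) UNIV" using a(1) by simp
  have "\<exists>X. finite X \<and> (\<forall>Y. finite Y \<longrightarrow> X \<subseteq> Y \<longrightarrow> infsum a UNIV - sum a Y \<le> e i)" for i
  proof -
    have "eventually (\<lambda>Y. dist (sum a Y) (infsum a UNIV) < e i) (finite_subsets_at_top UNIV)"
      using hs e[of i] unfolding has_sum_def tendsto_iff by blast
    then obtain X where X: "finite X"
        "\<And>Y. finite Y \<Longrightarrow> X \<subseteq> Y \<Longrightarrow> \<bar>sum a Y - infsum a UNIV\<bar> < e i"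
      unfolding eventually_finite_subsets_at_top dist_real_def by auto
    have "infsum a UNIV - sum a Y \<le> e i" if "finite Y" "X \<subseteq> Y" for Y
      using X(2)[OF that] by linarith
    then show ?thesis using X(1) by blast
  qed
  then obtain X where X: "\<And>i. finite (X i)"
      "\<And>i Y. finite Y \<Longrightarrow> X i \<subseteq> Y \<Longrightarrow> infsum a UNIV - sum a Y \<le> e i"
    by metis
  \<comment> \<open>The intervals make the union exhaust the integers; the earlier \<open>X l\<close> make the sequence increase.\<close>
  define F where "F i = (\<Union>l\<le>i. X l \<union> {- int l..int l})" for i
  show ?thesis
  proof
    show fin: "finite (F i)" for i using X by (auto simp: F_def)
    show sub: "F i \<subseteq> F (Suc i)" for i by (auto simp: F_def atMost_Suc)
    show "\<exists>n. \<forall>i\<ge>n. k \<in> F i" for k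
      by (intro exI[of _ "nat \<bar>k\<bar>"] allI impI) (auto simp: F_def intro!: bexI[of _ "nat \<bar>k\<bar>"])
    show "sum a (F (Suc i) - F i) \<le> e i" for i
    proof -
      have "sum a (F (Suc i)) \<le> infsum a UNIV"
        by (rule finite_sum_le_infsum) (use a fin in auto)
      moreover have "infsum a UNIV - sum a (F i) \<le> e i"
        by (rule X(2)[OF fin]) (auto simp: F_def)
      ultimately show ?thesis
        using sum_diff[OF fin[of "Suc i"] sub[of i], of a] by simp
    qed
  qed
qed

text \<open>Along a fast exhaustion of the frequencies the blocks \<open>h i\<close> of the Fourier series satisfy
  \<open>\<integral>\<bar>h i\<bar> \<le> 2\<^sup>-\<^sup>i\<close>.  Hence their sum converges absolutely almost everywhere to an integrable
  function, and coefficients may be computed block by block.  Square-integrability and the norm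
  bound follow from Fatou's lemma.\<close>

theorem riesz_fischer:
  fixes c :: "int \<Rightarrow> complex"
  assumes c: "(\<lambda>k. (cmod (c k))\<^sup>2) summable_on UNIV"
  obtains f where "f \<in> L2_functions" "\<And>k. fourier_coeff f k = c k"
    "(\<integral>x. (cmod (f x))\<^sup>2 \<partial>circle) \<le> (\<Sum>\<^sub>\<infinity>k. (cmod (c k))\<^sup>2)"
proof -
  let ?s = "\<Sum>\<^sub>\<infinity>k. (cmod (c k))\<^sup>2"
  obtain F where F: "\<And>i. finite (F i)" "\<And>i. F i \<subseteq> F (Suc i)" "\<And>k. \<exists>n. \<forall>i\<ge>n. k \<in> F i"
      "\<And>i. (\<Sum>k\<in>F (Suc i) - F i. (cmod (c k))\<^sup>2) \<le> ((1/2) ^ i)\<^sup>2"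
    using finite_exhaustion_with_small_increments[OF c, of "\<lambda>i. ((1/2) ^ i)\<^sup>2"] by auto
  define P where "P i x = (\<Sum>k\<in>F i. c k * cis (x * of_int k))" for i x
  define h where "h i x = (\<Sum>k\<in>F (Suc i) - F i. c k * cis (x * of_int k))" for i x
  have P_trig: "P i \<in> trig_polynomials" for i
    using trig_polynomial_sum[OF F(1)] unfolding P_def .
  have h_trig: "h i \<in> trig_polynomials" for i
    using trig_polynomial_sum[of "F (Suc i) - F i"] F(1) unfolding h_def by auto
  have [measurable]: "h i \<in> borel_measurable circle" "P i \<in> borel_measurable circle" for i
    using h_trig P_trig trig_polynomial_bounded_measurable by auto
  have P_step: "P (Suc i) x = P i x + h i x" for i x
    unfolding P_def h_def using sum.subset_diff[OF F(2) F(1)] by (simp add: add.commute)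
  have P_sum: "P n x = P 0 x + (\<Sum>i<n. h i x)" for n x
    by (induction n) (auto simp: P_step add.assoc)
  have h_L1: "(\<integral>x. cmod (h i x) \<partial>circle) \<le> (1/2) ^ i" for i
  proof (rule integral_norm_le_of_square)
    show "h i \<in> L2_functions" by (rule trig_polynomial_L2[OF h_trig])
    show "(\<integral>x. (cmod (h i x))\<^sup>2 \<partial>circle) \<le> ((1/2) ^ i)\<^sup>2"
      using F(4)[of i] integral_norm_square_trig_polynomial[of "F (Suc i) - F i" c] F(1)
      unfolding h_def by simp
  qed simp
  have h_int: "integrable circle (h i)" for i by (rule trig_polynomial_integrable[OF h_trig])
  have summable_L1: "summable (\<lambda>i. \<integral>x. cmod (h i x) \<partial>circle)"
    by (rule summable_comparison_test'[OF summable_geometric[of "1/2 :: real"]]) (use h_L1 in auto)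
  have AE_summable: "AE x in circle. summable (\<lambda>i. cmod (h i x))"
  proof -
    have "(\<integral>\<^sup>+x. (\<Sum>i. ennreal (cmod (h i x))) \<partial>circle) = (\<Sum>i. \<integral>\<^sup>+x. ennreal (cmod (h i x)) \<partial>circle)"
      by (rule nn_integral_suminf) auto
    also have "\<dots> = (\<Sum>i. ennreal (\<integral>x. cmod (h i x) \<partial>circle))"
      using h_int by (subst nn_integral_eq_integral) auto
    also have "\<dots> \<noteq> \<infinity>"
      unfolding infinity_ennreal_def by (rule ennreal_suminf_neq_top[OF summable_L1]) simp
    finally have "AE x in circle. (\<Sum>i. ennreal (cmod (h i x))) \<noteq> \<infinity>"
      by (intro nn_integral_PInf_AE) auto
    then show ?thesis
      by eventually_elim (rule summable_suminf_not_top, simp_all)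
  qed
  define f where "f x = P 0 x + (\<Sum>i. h i x)" for x
  have f_int: "integrable circle (\<lambda>x. \<Sum>i. h i x)"
    by (rule integrable_suminf[OF h_int AE_summable summable_L1])
  then have f_meas [measurable]: "f \<in> borel_measurable circle"
    unfolding f_def by measurable
  have lim: "AE x in circle. (\<lambda>n. P n x) \<longlonglongrightarrow> f x"
    using AE_summable
  proof eventually_elim
    case (elim x)
    have "(\<lambda>n. P 0 x + (\<Sum>i<n. h i x)) \<longlonglongrightarrow> P 0 x + (\<Sum>i. h i x)"
      by (intro tendsto_add tendsto_const summable_LIMSEQ summable_norm_cancel[OF elim])
    then show ?case
      unfolding f_def P_sum[symmetric] .
  qed
  have bound: "(\<integral>\<^sup>+x. ennreal ((cmod (f x))\<^sup>2) \<partial>circle) \<le> ennreal ?s"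
  proof -
    have "(\<integral>\<^sup>+x. ennreal ((cmod (f x))\<^sup>2) \<partial>circle)
        = (\<integral>\<^sup>+x. liminf (\<lambda>n. ennreal ((cmod (P n x))\<^sup>2)) \<partial>circle)"
    proof (rule nn_integral_cong_AE)
      show "AE x in circle. ennreal ((cmod (f x))\<^sup>2) = liminf (\<lambda>n. ennreal ((cmod (P n x))\<^sup>2))"
        using lim
      proof eventually_elim
        case (elim x)
        then have "(\<lambda>n. ennreal ((cmod (P n x))\<^sup>2)) \<longlonglongrightarrow> ennreal ((cmod (f x))\<^sup>2)"
          by (intro tendsto_intros tendsto_ennrealI)
        then show ?case
          by (rule lim_imp_Liminf[OF sequentially_bot, symmetric])
      qed
    qed
    also have "\<dots> \<le> liminf (\<lambda>n. \<integral>\<^sup>+x. ennreal ((cmod (P n x))\<^sup>2) \<partial>circle)"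
      by (rule nn_integral_liminf) auto
    also have "\<dots> \<le> limsup (\<lambda>n. \<integral>\<^sup>+x. ennreal ((cmod (P n x))\<^sup>2) \<partial>circle)"
      by (rule Liminf_le_Limsup) simp
    also have "\<dots> \<le> ennreal ?s"
    proof (rule Limsup_bounded, rule always_eventually, rule allI)
      fix n
      have "(\<integral>\<^sup>+x. ennreal ((cmod (P n x))\<^sup>2) \<partial>circle) = ennreal (\<Sum>k\<in>F n. (cmod (c k))\<^sup>2)"
        using trig_polynomial_L2[OF P_trig[of n]] integral_norm_square_trig_polynomial[OF F(1)[of n]]
        by (subst nn_integral_eq_integral) (auto simp: L2_functions_def P_def)
      also have "\<dots> \<le> ennreal ?s"
        by (intro ennreal_leI finite_sum_le_infsum) (use c F(1) in auto)
      finally show "(\<integral>\<^sup>+x. ennreal ((cmod (P n x))\<^sup>2) \<partial>circle) \<le> ennreal ?s" .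
    qed
    finally show ?thesis .
  qed
  have s_nonneg: "?s \<ge> 0" by (rule infsum_nonneg) simp
  have f_sq: "integrable circle (\<lambda>x. (cmod (f x))\<^sup>2)"
    by (rule integrableI_bounded) (use bound in \<open>auto simp: le_less_trans\<close>)
  show ?thesis
  proof
    show "f \<in> L2_functions" using f_sq by (simp add: L2_functions_def)
    show "(\<integral>x. (cmod (f x))\<^sup>2 \<partial>circle) \<le> ?s"
      using bound f_sq s_nonneg by (subst (asm) nn_integral_eq_integral) auto
    fix k
    let ?e = "\<lambda>x. cis (- (x * of_int k))"
    have e_meas [measurable]: "?e \<in> borel_measurable circle"
      using cis_integer_measurable[of "- k"] by simp
    have int: "integrable circle (\<lambda>x. h i x * ?e x)" for i
      using integrable_mult_bounded[OF h_int e_meas, of 1] by simp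
    have "(\<lambda>i. \<integral>x. h i x * ?e x \<partial>circle) sums (\<integral>x. (\<Sum>i. h i x * ?e x) \<partial>circle)"
      by (rule sums_integral[OF int]) (use AE_summable summable_L1 in \<open>simp_all add: norm_mult\<close>)
    moreover have "(\<integral>x. (\<Sum>i. h i x * ?e x) \<partial>circle) = (\<integral>x. (\<Sum>i. h i x) * ?e x \<partial>circle)"
    proof (rule integral_cong_AE)
      show "AE x in circle. (\<Sum>i. h i x * ?e x) = (\<Sum>i. h i x) * ?e x"
        using AE_summable
        by eventually_elim (auto simp: suminf_mult2[symmetric] dest: summable_norm_cancel)
      show "(\<lambda>x. (\<Sum>i. h i x) * ?e x) \<in> borel_measurable circle"
        using f_int by (intro borel_measurable_times) auto
    qed measurable
    ultimately have "(\<lambda>n. \<Sum>i<n. fourier_coeff (h i) k) \<longlonglongrightarrow> fourier_coeff (\<lambda>x. \<Sum>i. h i x) k"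
      by (simp add: sums_def fourier_coeff_def)
    then have "(\<lambda>n. fourier_coeff (P 0) k + (\<Sum>i<n. fourier_coeff (h i) k))
        \<longlonglongrightarrow> fourier_coeff (P 0) k + fourier_coeff (\<lambda>x. \<Sum>i. h i x) k"
      by (intro tendsto_intros)
    moreover have "fourier_coeff (P 0) k + fourier_coeff (\<lambda>x. \<Sum>i. h i x) k = fourier_coeff f k"
      unfolding fourier_coeff_def f_def distrib_right
      using integrable_mult_bounded[OF f_int e_meas, of 1]
        integrable_mult_bounded[OF trig_polynomial_integrable[OF P_trig] e_meas, of 1]
      by (subst Bochner_Integration.integral_add) auto
    moreover have "fourier_coeff (P 0) k + (\<Sum>i<n. fourier_coeff (h i) k) = fourier_coeff (P n) k" for n
    proof (induction n)
      case (Suc n)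
      have "fourier_coeff (P (Suc n)) k = fourier_coeff (P n) k + fourier_coeff (h n) k"
        unfolding fourier_coeff_def P_step distrib_right
        using integrable_mult_bounded[OF trig_polynomial_integrable[OF P_trig] e_meas, of 1] int
        by (subst Bochner_Integration.integral_add) auto
      then show ?case using Suc by simp
    qed simp
    ultimately have "(\<lambda>n. fourier_coeff (P n) k) \<longlonglongrightarrow> fourier_coeff f k" by simp
    moreover have "(\<lambda>n. fourier_coeff (P n) k) \<longlonglongrightarrow> c k"
    proof (rule tendsto_eventually)
      obtain n where n: "\<forall>i\<ge>n. k \<in> F i" using F(3) by blast
      have "fourier_coeff (P i) k = c k" if "i \<ge> n" for i
        using fourier_coeff_trig_polynomial[OF F(1)[of i], of c k] n that by (simp add: P_def[abs_def])
      then show "eventually (\<lambda>n. fourier_coeff (P n) k = c k) sequentially"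
        by (auto simp: eventually_sequentially)
    qed
    ultimately show "fourier_coeff f k = c k"
      by (rule LIMSEQ_unique)
  qed
qed

section \<open>Parseval's identity\<close>

lemma L2_eq_refl: "f \<in> L2_functions \<Longrightarrow> L2_eq f f"
  by (simp add: L2_eq_def)

lift_definition L2_coeff :: "L2_circle \<Rightarrow> int \<Rightarrow> complex" is fourier_coeff
proof
  fix f g :: "real \<Rightarrow> complex" and k
  assume fg: "L2_eq f g"
  then have "f \<in> L2_functions" "g \<in> L2_functions" and ae: "AE x in circle. f x = g x"
    by (auto simp: L2_eq_def)
  note int = L2_integrable_cis[OF this(1)] L2_integrable_cis[OF this(2)]
  show "fourier_coeff f k = fourier_coeff g k"
    unfolding fourier_coeff_def
    by (rule integral_cong_AE[OF borel_measurable_integrable[OF int(1)] borel_measurable_integrable[OF int(2)]])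
       (use ae in eventually_elim, simp)
qed

lemma L2_coeff_class: "f \<in> L2_functions \<Longrightarrow> L2_coeff (class_L2 f) = fourier_coeff f"
  by (rule L2_coeff.abs_eq) (rule L2_eq_refl)

lemma L2_coeff_add: "L2_coeff (f + g) k = L2_coeff f k + L2_coeff g k"
  by transfer (simp add: L2_eq_def fourier_coeff_def distrib_right L2_integrable_cis)

lemma L2_coeff_diff: "L2_coeff (f - g) k = L2_coeff f k - L2_coeff g k"
  by transfer (simp add: L2_eq_def fourier_coeff_def left_diff_distrib L2_integrable_cis)

lemma L2_coeff_scaleC: "L2_coeff (scaleC_L2 c f) k = c * L2_coeff f k"
  by transfer (simp add: fourier_coeff_def mult.assoc)

lemma L2_coeff_scaleR: "L2_coeff (r *\<^sub>R f) k = of_real r * L2_coeff f k"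
  by transfer (simp add: fourier_coeff_def mult.assoc scaleR_conv_of_real)

lemma L2_coeff_zero: "L2_coeff 0 k = 0"
  by transfer (simp add: fourier_coeff_def)

lemma L2_coeff_sum: "L2_coeff (\<Sum>i\<in>I. f i) k = (\<Sum>i\<in>I. L2_coeff (f i) k)"
  by (induction I rule: infinite_finite_induct) (simp_all add: L2_coeff_zero L2_coeff_add)

lemma L2_coeff_inject:
  assumes "\<And>k. L2_coeff f k = L2_coeff g k"
  shows "f = g"
proof -
  have "L2_coeff (f - g) k = 0" for k
    by (simp add: L2_coeff_diff assms)
  moreover have "h = 0" if "\<And>k. L2_coeff h k = 0" for h
    using that
  proof transfer
    fix h assume h: "L2_eq h h" and zero: "\<And>k. fourier_coeff h k = 0"
    then have "h \<in> L2_functions" by (simp add: L2_eq_def)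
    with fourier_coeff_zero_imp_AE_zero[OF L2_integrable zero]
    show "L2_eq h (\<lambda>x. 0)" by (simp add: L2_eq_def L2_zero)
  qed
  ultimately have "f - g = 0" by blast
  then show ?thesis by simp
qed

text \<open>The expansion of the squared distance from \<open>f\<close> to the partial sum of its Fourier series over
  \<open>S\<close> is the difference of the two sides, and it is nonnegative.\<close>

lemma bessel_inequality:
  assumes S: "finite S"
  shows "(\<Sum>k\<in>S. (cmod (L2_coeff f k))\<^sup>2) \<le> (norm f)\<^sup>2"
proof (transfer fixing: S)
  fix f assume "L2_eq f f"
  then have f: "f \<in> L2_functions" by (simp add: L2_eq_def)
  let ?c = "fourier_coeff f"
  let ?p = "\<lambda>x. \<Sum>k\<in>S. ?c k * cis (x * of_int k)"
  let ?s = "\<Sum>k\<in>S. (cmod (?c k))\<^sup>2"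
  have p: "?p \<in> L2_functions"
    by (rule trig_polynomial_L2[OF trig_polynomial_sum[OF S]])
  note int = L2_integrable_prod[OF f p]
  have "(\<integral>x. f x * cnj (?p x) \<partial>circle) = (\<integral>x. (\<Sum>k\<in>S. cnj (?c k) * (f x * cis (- (x * of_int k)))) \<partial>circle)"
    by (intro Bochner_Integration.integral_cong refl)
      (simp only: cnj_sum complex_cnj_mult cnj_cis_integer sum_distrib_left mult.left_commute)
  also have "\<dots> = (\<Sum>k\<in>S. \<integral>x. cnj (?c k) * (f x * cis (- (x * of_int k))) \<partial>circle)"
    by (rule Bochner_Integration.integral_sum) (intro integrable_mult_right L2_integrable_cis f)
  also have "\<dots> = (\<Sum>k\<in>S. cnj (?c k) * ?c k)"
    unfolding integral_mult_right_zero fourier_coeff_def ..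
  also have "\<dots> = complex_of_real ?s"
    unfolding of_real_sum by (intro sum.cong refl) (metis complex_norm_square mult.commute)
  finally have cross: "(\<integral>x. f x * cnj (?p x) \<partial>circle) = complex_of_real ?s" .
  have sq: "integrable circle (\<lambda>x. (cmod (f x))\<^sup>2)" "integrable circle (\<lambda>x. (cmod (?p x))\<^sup>2)"
    using f p by (auto simp: L2_functions_def)
  have lin: "(\<integral>x. a x + b x - 2 * r x \<partial>circle) = (\<integral>x. a x \<partial>circle) + (\<integral>x. b x \<partial>circle) - 2 * (\<integral>x. r x \<partial>circle)"
    if "integrable circle a" "integrable circle b" "integrable circle r" for a b r :: "real \<Rightarrow> real"
    using that by simp
  have "0 \<le> (\<integral>x. (cmod (f x - ?p x))\<^sup>2 \<partial>circle)" by simp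
  also have "\<dots> = (\<integral>x. (cmod (f x))\<^sup>2 + (cmod (?p x))\<^sup>2 - 2 * Re (f x * cnj (?p x)) \<partial>circle)"
  proof (intro Bochner_Integration.integral_cong refl)
    show "(cmod (a - b))\<^sup>2 = (cmod a)\<^sup>2 + (cmod b)\<^sup>2 - 2 * Re (a * cnj b)" for a b
      by (simp add: cmod_power2 power2_diff algebra_simps)
  qed
  also have "\<dots> = (\<integral>x. (cmod (f x))\<^sup>2 \<partial>circle) + (\<integral>x. (cmod (?p x))\<^sup>2 \<partial>circle)
      - 2 * (\<integral>x. Re (f x * cnj (?p x)) \<partial>circle)"
    by (rule lin[OF sq integrable_Re[OF int]])
  also have "(\<integral>x. Re (f x * cnj (?p x)) \<partial>circle) = ?s"
    using cross integral_Re[OF int] by simp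
  also have "(\<integral>x. (cmod (?p x))\<^sup>2 \<partial>circle) = ?s"
    by (rule integral_norm_square_trig_polynomial[OF S])
  finally show "?s \<le> (sqrt (\<integral>x. (cmod (f x))\<^sup>2 \<partial>circle))\<^sup>2" by simp
qed

definition square_summable :: "('a \<Rightarrow> complex) \<Rightarrow> bool" where
  "square_summable u \<longleftrightarrow> (\<lambda>k. (cmod (u k))\<^sup>2) summable_on UNIV"

lemma square_summableI:
  assumes "\<And>F. finite F \<Longrightarrow> (\<Sum>k\<in>F. (cmod (u k))\<^sup>2) \<le> b"
  shows "square_summable u"
  unfolding square_summable_def
  by (rule nonneg_bdd_above_summable_on) (auto intro!: bdd_aboveI2 assms)

lemma square_summable_L2_coeff: "square_summable (L2_coeff f)"
  by (rule square_summableI) (rule bessel_inequality)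

lemma L2_coeff_exists:
  assumes "square_summable c"
  obtains f where "L2_coeff f = c" "(norm f)\<^sup>2 \<le> (\<Sum>\<^sub>\<infinity>k. (cmod (c k))\<^sup>2)"
proof -
  obtain f where f: "f \<in> L2_functions" "\<And>k. fourier_coeff f k = c k"
    "(\<integral>x. (cmod (f x))\<^sup>2 \<partial>circle) \<le> (\<Sum>\<^sub>\<infinity>k. (cmod (c k))\<^sup>2)"
    using riesz_fischer assms unfolding square_summable_def by blast
  show ?thesis
  proof
    show "L2_coeff (class_L2 f) = c"
      using f by (auto simp: L2_coeff_class)
    have "norm (class_L2 f) = sqrt (\<integral>x. (cmod (f x))\<^sup>2 \<partial>circle)"
      using f(1) by (simp add: norm_L2_circle.abs_eq L2_eq_refl)
    then show "(norm (class_L2 f))\<^sup>2 \<le> (\<Sum>\<^sub>\<infinity>k. (cmod (c k))\<^sup>2)"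
      using f(3) by simp
  qed
qed

text \<open>Completeness of the trigonometric system comes from comparing two functions with the same
  coefficients: the one produced by the Riesz-Fischer theorem has squared norm at most the sum of the
  squares, and by uniqueness it is \<open>f\<close>.  Bessel's inequality is the other half.\<close>

theorem parseval: "((\<lambda>k. (cmod (L2_coeff f k))\<^sup>2) has_sum (norm f)\<^sup>2) UNIV"
proof -
  let ?s = "\<Sum>\<^sub>\<infinity>k. (cmod (L2_coeff f k))\<^sup>2"
  have hs: "((\<lambda>k. (cmod (L2_coeff f k))\<^sup>2) has_sum ?s) UNIV"
    using square_summable_L2_coeff[of f] by (simp add: square_summable_def)
  obtain g where "L2_coeff g = L2_coeff f" and g: "(norm g)\<^sup>2 \<le> ?s"
    using L2_coeff_exists[OF square_summable_L2_coeff] .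
  then have "g = f" by (intro L2_coeff_inject) simp
  then have "(norm f)\<^sup>2 \<le> ?s" using g by simp
  moreover have "?s \<le> (norm f)\<^sup>2"
    by (rule has_sum_le_finite_sums[OF hs]) (rule bessel_inequality)
  ultimately show ?thesis using hs by simp
qed

section \<open>Square-summable sequences\<close>

lemma square_summable_mult_abs:
  assumes "square_summable u" "square_summable v"
  shows "(\<lambda>k. cmod (u k * v k)) summable_on UNIV"
proof (rule Infinite_Sum.abs_summable_on_comparison_test')
  show "(\<lambda>k. (cmod (u k))\<^sup>2 + (cmod (v k))\<^sup>2) summable_on UNIV"
    using assms unfolding square_summable_def by (rule summable_on_add)
  fix k
  have "0 \<le> (cmod (u k) - cmod (v k))\<^sup>2" "0 \<le> cmod (u k) * cmod (v k)" by simp_all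
  then show "cmod (u k * v k) \<le> (cmod (u k))\<^sup>2 + (cmod (v k))\<^sup>2"
    unfolding norm_mult power2_diff by linarith
qed

lemma square_summable_mult:
  "square_summable u \<Longrightarrow> square_summable v \<Longrightarrow> (\<lambda>k. u k * v k) summable_on UNIV"
  by (rule abs_summable_summable[OF square_summable_mult_abs])

lemma square_summable_cnj: "square_summable (\<lambda>k. cnj (u k)) \<longleftrightarrow> square_summable u"
  by (simp add: square_summable_def)

lemma infsum_Cauchy_Schwarz:
  assumes u: "square_summable u" and v: "square_summable v"
  shows "(cmod (\<Sum>\<^sub>\<infinity>k. u k * v k))\<^sup>2 \<le> (\<Sum>\<^sub>\<infinity>k. (cmod (u k))\<^sup>2) * (\<Sum>\<^sub>\<infinity>k. (cmod (v k))\<^sup>2)"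
    (is "_ \<le> ?A * ?B")
proof -
  have A: "?A \<ge> 0" and B: "?B \<ge> 0" by (intro infsum_nonneg; simp)+
  have "cmod (\<Sum>\<^sub>\<infinity>k. u k * v k) \<le> (\<Sum>\<^sub>\<infinity>k. cmod (u k * v k))"
    by (rule norm_infsum_bound[OF square_summable_mult_abs[OF u v]])
  also have "\<dots> \<le> sqrt (?A * ?B)"
  proof (rule infsum_le_finite_sums[OF square_summable_mult_abs[OF u v]])
    fix F :: "'a set" assume "finite F"
    then have FA: "(\<Sum>k\<in>F. (cmod (u k))\<^sup>2) \<le> ?A" and FB: "(\<Sum>k\<in>F. (cmod (v k))\<^sup>2) \<le> ?B"
      using u v by (intro finite_sum_le_infsum; simp add: square_summable_def)+
    have "(\<Sum>k\<in>F. cmod (u k) * cmod (v k))\<^sup>2 \<le> (\<Sum>k\<in>F. (cmod (u k))\<^sup>2) * (\<Sum>k\<in>F. (cmod (v k))\<^sup>2)"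
      by (rule Cauchy_Schwarz_ineq_sum)
    also have "\<dots> \<le> ?A * ?B"
      by (intro mult_mono FA FB A sum_nonneg) auto
    finally show "(\<Sum>k\<in>F. cmod (u k * v k)) \<le> sqrt (?A * ?B)"
      by (simp add: norm_mult real_le_rsqrt)
  qed
  finally have "(cmod (\<Sum>\<^sub>\<infinity>k. u k * v k))\<^sup>2 \<le> (sqrt (?A * ?B))\<^sup>2"
    by (intro power_mono) auto
  then show ?thesis using A B by simp
qed

lemma has_sum_finite_sum:
  fixes f :: "'i \<Rightarrow> 'a \<Rightarrow> 'b::{topological_comm_monoid_add}"
  assumes "\<And>i. i \<in> I \<Longrightarrow> (f i has_sum s i) A"
  shows "((\<lambda>x. \<Sum>i\<in>I. f i x) has_sum (\<Sum>i\<in>I. s i)) A"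
  using assms
  by (induction I rule: infinite_finite_induct) (auto intro: has_sum_add)

lemma mult_cnj_eq_norm_square: "cnj z * z = of_real ((cmod z)\<^sup>2)"
  by (metis complex_norm_square mult.commute)

text \<open>If \<open>Q = B\<^sup>* B\<close> entrywise on \<open>F\<close>, then \<open>\<langle>Q v, v\<rangle> = \<parallel>B v\<parallel>\<^sup>2\<close> for \<open>v\<close> supported in \<open>F\<close>.  The lemma
  serves both for \<open>Q = G\<close>, with \<open>B\<close> the symbol matrix, and for \<open>Q = G\<^sup>2\<^sup>n\<close>, with \<open>B = G\<^sup>n\<close>.\<close>

lemma quadratic_form_of_gram_entries:
  fixes B :: "'a \<Rightarrow> 'i \<Rightarrow> complex"
  assumes "\<And>j k. j \<in> F \<Longrightarrow> k \<in> F \<Longrightarrow> ((\<lambda>h. cnj (B h j) * B h k) has_sum Q j k) UNIV"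
  shows "((\<lambda>h. of_real ((cmod (\<Sum>k\<in>F. B h k * v k))\<^sup>2)) has_sum
           (\<Sum>j\<in>F. \<Sum>k\<in>F. cnj (v j) * Q j k * v k)) UNIV"
proof -
  have "((\<lambda>h. \<Sum>j\<in>F. \<Sum>k\<in>F. cnj (v j) * (cnj (B h j) * B h k) * v k) has_sum
           (\<Sum>j\<in>F. \<Sum>k\<in>F. cnj (v j) * Q j k * v k)) UNIV"
    by (intro has_sum_finite_sum has_sum_cmult_left has_sum_cmult_right assms)
  also have "(\<lambda>h. \<Sum>j\<in>F. \<Sum>k\<in>F. cnj (v j) * (cnj (B h j) * B h k) * v k)
      = (\<lambda>h. of_real ((cmod (\<Sum>k\<in>F. B h k * v k))\<^sup>2))"
    by (intro ext, unfold mult_cnj_eq_norm_square[symmetric] cnj_sum sum_product, intro sum.cong refl)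
      (simp add: mult_ac)
  finally show ?thesis .
qed

section \<open>Powers of a Hermitian matrix\<close>

text \<open>Taking \<open>2\<^sup>m\<close>-th roots makes the constants \<open>c\<close> and \<open>L\<close> irrelevant as \<open>m\<close> grows.\<close>

lemma le_of_double_power_bounds:
  fixes a b c L :: real
  assumes "a \<ge> 0" "b \<ge> 0" "c > 0" and le: "\<And>m. m \<ge> 1 \<Longrightarrow> c * a ^ (2 ^ m) \<le> L * b ^ (2 ^ m)"
  shows "a \<le> b"
proof (rule ccontr)
  assume "\<not> a \<le> b"
  then have "a > b" by simp
  show False
  proof (cases "b = 0")
    case True
    then have "c * a\<^sup>2 \<le> 0" using le[of 1] by simp
    then show False using \<open>a > b\<close> \<open>c > 0\<close> True by (simp add: mult_le_0_iff)
  next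
    case False
    then have "b > 0" using \<open>b \<ge> 0\<close> by simp
    define r where "r = a / b"
    have "r > 1" using \<open>a > b\<close> \<open>b > 0\<close> by (simp add: r_def)
    then obtain n where n: "L / c < r ^ n" using real_arch_pow by blast
    have "r ^ n \<le> r ^ (2 ^ Suc n)"
    proof (rule power_increasing)
      show "n \<le> 2 ^ Suc n" using less_exp[of "Suc n"] by linarith
    qed (use \<open>r > 1\<close> in simp)
    also have "\<dots> \<le> L / c"
    proof -
      have "c * r ^ (2 ^ Suc n) * b ^ (2 ^ Suc n) \<le> L * b ^ (2 ^ Suc n)"
        using le[of "Suc n"] \<open>b > 0\<close> by (simp add: r_def power_divide)
      then have "c * r ^ (2 ^ Suc n) \<le> L"
        using \<open>b > 0\<close> by (simp only: mult_le_cancel_right_pos zero_less_power)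
      then show ?thesis using \<open>c > 0\<close> by (simp add: pos_le_divide_eq mult.commute)
    qed
    finally show False using n by simp
  qed
qed

lemma mat_pow_1: "mat_pow P (Suc 0) = P"
proof (intro ext)
  fix j k
  have "((\<lambda>h. (if j = h then 1 else 0) * P h k) has_sum P j k) UNIV"
    by (rule has_sum_finite_neutralI[of "{j}"]) auto
  then show "mat_pow P (Suc 0) j k = P j k"
    by (simp add: mat_mult_def infsumI)
qed

text \<open>The abstract situation of the Gram matrix: nothing is known about boundedness, only that the
  powers exist as matrices.\<close>

locale hermitian_with_powers =
  fixes G :: int_matrix
  assumes hermitian: "mat_adj G = G"
    and powers_defined: "\<And>n. n \<ge> 1 \<Longrightarrow> mat_pow_defined G n"
begin

lemma mat_pow_add_has_sum:
  assumes "i \<ge> 1" "j \<ge> 1"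
  shows "((\<lambda>h. mat_pow G i a h * mat_pow G j h b) has_sum mat_pow G (i + j) a b) UNIV"
proof -
  have "mat_mult_defined (mat_pow G i) (mat_pow G j)"
    and eq: "mat_mult (mat_pow G i) (mat_pow G j) = mat_pow G (i + j)"
    using powers_defined[of "i + j"] assms unfolding mat_pow_defined_def by auto
  then have "(\<lambda>h. mat_pow G i a h * mat_pow G j h b) summable_on UNIV"
    unfolding mat_mult_defined_def by blast
  then show ?thesis
    unfolding eq[symmetric] mat_mult_def by simp
qed

text \<open>Taking adjoints turns \<open>G\<^sup>n G\<close> into \<open>G G\<^sup>n\<close>, and these agree because the powers do not
  depend on the bracketing.\<close>

lemma mat_pow_hermitian:
  assumes "n \<ge> 1"
  shows "cnj (mat_pow G n k j) = mat_pow G n j k"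
  using assms
proof (induction n arbitrary: j k rule: dec_induct)
  case base
  have "cnj (G k j) = G j k" using fun_cong[OF fun_cong[OF hermitian]] by (simp add: mat_adj_def)
  then show ?case by (simp add: mat_pow_1 del: mat_pow.simps)
next
  case (step n)
  have G: "cnj (mat_pow G 1 a b) = mat_pow G 1 b a" for a b
    using fun_cong[OF fun_cong[OF hermitian]] by (simp add: mat_adj_def mat_pow_1 del: mat_pow.simps)
  have "((\<lambda>h. cnj (mat_pow G n k h * mat_pow G 1 h j)) has_sum cnj (mat_pow G (n + 1) k j)) UNIV"
    using mat_pow_add_has_sum[of n 1 k j] step(1) by (simp only: has_sum_cnj_iff)
  moreover have "(\<lambda>h. cnj (mat_pow G n k h * mat_pow G 1 h j)) = (\<lambda>h. mat_pow G 1 j h * mat_pow G n h k)"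
    by (simp only: complex_cnj_mult step.IH G mult.commute)
  moreover have "((\<lambda>h. mat_pow G 1 j h * mat_pow G n h k) has_sum mat_pow G (1 + n) j k) UNIV"
    by (rule mat_pow_add_has_sum) (use step(1) in auto)
  ultimately have "cnj (mat_pow G (n + 1) k j) = mat_pow G (1 + n) j k"
    using has_sum_unique by metis
  then show ?case by (simp only: Suc_eq_plus1 add.commute)
qed

lemma mat_pow_gram_has_sum:
  assumes "n \<ge> 1"
  shows "((\<lambda>h. cnj (mat_pow G n h j) * mat_pow G n h k) has_sum mat_pow G (2 * n) j k) UNIV"
  using mat_pow_add_has_sum[OF assms assms, of j k]
  by (simp only: mat_pow_hermitian[OF assms] mult_2)

lemma mat_pow_column_has_sum:
  assumes "n \<ge> 1"
  shows "((\<lambda>h. (cmod (mat_pow G n h k))\<^sup>2) has_sum cmod (mat_pow G (2 * n) k k)) UNIV"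
proof -
  have "((\<lambda>h. complex_of_real ((cmod (mat_pow G n h k))\<^sup>2)) has_sum mat_pow G (2 * n) k k) UNIV"
    using mat_pow_gram_has_sum[OF assms, of k k] by (simp only: mult_cnj_eq_norm_square)
  from has_sum_Re[OF this]
  have hs: "((\<lambda>h. (cmod (mat_pow G n h k))\<^sup>2) has_sum Re (mat_pow G (2 * n) k k)) UNIV"
    by (simp only: Re_complex_of_real)
  moreover have "Re (mat_pow G (2 * n) k k) = cmod (mat_pow G (2 * n) k k)"
  proof -
    have "Im (mat_pow G (2 * n) k k) = 0"
      using mat_pow_hermitian[of "2 * n" k k] assms by (auto simp: complex_eq_iff simp del: mat_pow.simps)
    moreover have "Re (mat_pow G (2 * n) k k) \<ge> 0"
      by (rule has_sum_nonneg[OF hs]) simp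
    ultimately show ?thesis by (simp add: cmod_def)
  qed
  ultimately show ?thesis by simp
qed

lemma mat_pow_column_square_summable:
  "n \<ge> 1 \<Longrightarrow> square_summable (\<lambda>h. mat_pow G n h k)"
  using mat_pow_column_has_sum has_sum_imp_summable unfolding square_summable_def by blast

text \<open>The entry of \<open>G\<^sup>2\<^sup>n\<close> at \<open>(j, k)\<close> is the inner product of two columns of \<open>G\<^sup>n\<close>, and the
  squared norms of these columns are diagonal entries of \<open>G\<^sup>2\<^sup>n\<close>.\<close>

lemma mat_pow_even_entry_bound:
  assumes diag: "\<And>n k. n \<ge> 1 \<Longrightarrow> cmod (mat_pow G n k k) \<le> C ^ n" and n: "n \<ge> 1" and "C \<ge> 0"
  shows "cmod (mat_pow G (2 * n) j k) \<le> C ^ (2 * n)"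
proof -
  have "(cmod (mat_pow G (2 * n) j k))\<^sup>2 = (cmod (\<Sum>\<^sub>\<infinity>h. cnj (mat_pow G n h j) * mat_pow G n h k))\<^sup>2"
    using infsumI[OF mat_pow_gram_has_sum[OF n, of j k]] by simp
  also have "\<dots> \<le> (\<Sum>\<^sub>\<infinity>h. (cmod (cnj (mat_pow G n h j)))\<^sup>2) * (\<Sum>\<^sub>\<infinity>h. (cmod (mat_pow G n h k))\<^sup>2)"
    by (intro infsum_Cauchy_Schwarz mat_pow_column_square_summable n square_summable_cnj[THEN iffD2])
  also have "\<dots> = cmod (mat_pow G (2 * n) j j) * cmod (mat_pow G (2 * n) k k)"
    using infsumI[OF mat_pow_column_has_sum[OF n]] by simp
  also have "\<dots> \<le> C ^ (2 * n) * C ^ (2 * n)"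
    by (intro mult_mono diag) (use n \<open>C \<ge> 0\<close> in auto)
  finally have "(cmod (mat_pow G (2 * n) j k))\<^sup>2 \<le> (C ^ (2 * n))\<^sup>2"
    by (simp only: power2_eq_square)
  then show ?thesis
    by (rule power2_le_imp_le) (use \<open>C \<ge> 0\<close> in simp)
qed

text \<open>With \<open>q n = \<langle>G\<^sup>n v, v\<rangle>\<close> and \<open>N = \<parallel>v\<parallel>\<^sup>2\<close>, the inequality \<open>\<bar>q n\<bar>\<^sup>2 \<le> N \<bar>q (2n)\<bar>\<close> iterates to
  \<open>N \<bar>q 1\<bar>\<^sup>k \<le> N\<^sup>k \<bar>q k\<bar>\<close> for \<open>k\<close> a power of two, and \<open>\<bar>q k\<bar>\<close> is at most a constant times \<open>C\<^sup>k\<close>.\<close>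

theorem quadratic_form_le_of_diagonal_growth:
  assumes diag: "\<And>n k. n \<ge> 1 \<Longrightarrow> cmod (mat_pow G n k k) \<le> C ^ n" and "C \<ge> 0" and "finite F"
  shows "cmod (\<Sum>j\<in>F. \<Sum>k\<in>F. cnj (v j) * G j k * v k) \<le> C * (\<Sum>k\<in>F. (cmod (v k))\<^sup>2)"
proof -
  define q where "q n = (\<Sum>j\<in>F. \<Sum>k\<in>F. cnj (v j) * mat_pow G n j k * v k)" for n
  define N where "N = (\<Sum>k\<in>F. (cmod (v k))\<^sup>2)"
  have N: "N \<ge> 0" unfolding N_def by (intro sum_nonneg) simp
  have doubling: "(cmod (q n))\<^sup>2 \<le> N * cmod (q (2 * n))" if n: "n \<ge> 1" for n
  proof -
    \<comment> \<open>The vector \<open>w\<close> is \<open>G\<^sup>n v\<close>, whose squared norm is \<open>q (2n)\<close>.\<close>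
    define w where "w h = (\<Sum>k\<in>F. mat_pow G n h k * v k)" for h
    have "((\<lambda>h. complex_of_real ((cmod (w h))\<^sup>2)) has_sum q (2 * n)) UNIV"
      unfolding w_def q_def by (intro quadratic_form_of_gram_entries mat_pow_gram_has_sum n)
    then have hs: "((\<lambda>h. (cmod (w h))\<^sup>2) has_sum Re (q (2 * n))) UNIV"
      using has_sum_Re by fastforce
    have "cmod (q n) = cmod (\<Sum>j\<in>F. cnj (v j) * w j)"
      unfolding q_def w_def by (simp add: sum_distrib_left mult.assoc)
    also have "\<dots> \<le> (\<Sum>j\<in>F. cmod (v j) * cmod (w j))"
      by (rule order.trans[OF norm_sum]) (simp add: norm_mult)
    finally have "(cmod (q n))\<^sup>2 \<le> (\<Sum>j\<in>F. cmod (v j) * cmod (w j))\<^sup>2"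
      by (rule power_mono) simp
    also have "\<dots> \<le> N * (\<Sum>j\<in>F. (cmod (w j))\<^sup>2)"
      unfolding N_def by (rule Cauchy_Schwarz_ineq_sum)
    also have "\<dots> \<le> N * Re (q (2 * n))"
      by (intro mult_left_mono N finite_sum_le_has_sum[OF hs]) (use \<open>finite F\<close> in auto)
    also have "\<dots> \<le> N * cmod (q (2 * n))"
      by (intro mult_left_mono N complex_Re_le_cmod)
    finally show ?thesis .
  qed
  have "cmod (q 1) \<le> C * N"
  proof (cases "N = 0")
    case True
    then have "v k = 0" if "k \<in> F" for k
      using that \<open>finite F\<close> unfolding N_def by (subst (asm) sum_nonneg_eq_0_iff) auto
    then have "q 1 = 0" unfolding q_def by (intro sum.neutral ballI) simp
    then show ?thesis using True by simp
  next
    case False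
    then have "N > 0" using N by simp
    have chain: "N * cmod (q 1) ^ (2 ^ m) \<le> N ^ (2 ^ m) * cmod (q (2 ^ m))" for m
    proof (induction m)
      case (Suc m)
      have "N * (N * cmod (q 1) ^ (2 ^ Suc m)) = (N * cmod (q 1) ^ (2 ^ m))\<^sup>2"
        unfolding power_Suc2 power_mult by (simp add: power2_eq_square mult_ac)
      also have "\<dots> \<le> (N ^ (2 ^ m) * cmod (q (2 ^ m)))\<^sup>2"
        by (rule power_mono[OF Suc]) (use N in simp)
      also have "\<dots> = N ^ (2 ^ Suc m) * (cmod (q (2 ^ m)))\<^sup>2"
        unfolding power_Suc2 power_mult by (simp add: power_mult_distrib)
      also have "\<dots> \<le> N ^ (2 ^ Suc m) * (N * cmod (q (2 * 2 ^ m)))"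
        by (intro mult_left_mono doubling) (use N in auto)
      finally have "N * (N * cmod (q 1) ^ (2 ^ Suc m)) \<le> N * (N ^ (2 ^ Suc m) * cmod (q (2 ^ Suc m)))"
        by (simp only: mult_ac power_Suc)
      then show ?case using \<open>N > 0\<close> by (simp only: mult_le_cancel_left_pos)
    qed simp
    define L where "L = (\<Sum>j\<in>F. \<Sum>k\<in>F. cmod (v j) * cmod (v k))"
    have growth: "cmod (q (2 * n)) \<le> L * C ^ (2 * n)" if "n \<ge> 1" for n
    proof -
      have "cmod (q (2 * n)) \<le> (\<Sum>j\<in>F. \<Sum>k\<in>F. cmod (v j) * cmod (v k) * C ^ (2 * n))"
        unfolding q_def
      proof (intro order.trans[OF norm_sum] sum_mono)
        fix j k
        have "cmod (v j) * (cmod (mat_pow G (2 * n) j k) * cmod (v k)) \<le> cmod (v j) * (C ^ (2 * n) * cmod (v k))"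
          by (intro mult_left_mono mult_right_mono mat_pow_even_entry_bound diag that \<open>C \<ge> 0\<close>) auto
        then show "cmod (cnj (v j) * mat_pow G (2 * n) j k * v k) \<le> cmod (v j) * cmod (v k) * C ^ (2 * n)"
          by (simp add: norm_mult mult_ac)
      qed
      then show ?thesis by (simp add: L_def sum_distrib_right)
    qed
    show ?thesis
    proof (rule le_of_double_power_bounds)
      fix m :: nat assume "m \<ge> 1"
      \<comment> \<open>Entries are controlled for even exponents, so the first power of two is left out.\<close>
      then obtain l where l: "m = Suc l" by (cases m) auto
      have "N * cmod (q 1) ^ (2 ^ m) \<le> N ^ (2 ^ m) * cmod (q (2 ^ m))" by (rule chain)
      also have "\<dots> \<le> N ^ (2 ^ m) * (L * C ^ (2 ^ m))"
        using growth[of "2 ^ l"] N by (intro mult_left_mono) (auto simp: l)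
      finally show "N * cmod (q 1) ^ (2 ^ m) \<le> L * (C * N) ^ (2 ^ m)"
        by (simp add: power_mult_distrib mult_ac)
    qed (use N \<open>N > 0\<close> \<open>C \<ge> 0\<close> in auto)
  qed
  then show ?thesis
    by (simp only: q_def N_def One_nat_def mat_pow_1)
qed

end

section \<open>Bounded operators and their matrices\<close>

definition L2_cis :: "int \<Rightarrow> L2_circle" where
  "L2_cis k = class_L2 (\<lambda>x. cis (x * of_int k))"

lemma L2_coeff_cis: "L2_coeff (L2_cis k) j = (if j = k then 1 else 0)"
proof -
  have "fourier_coeff (\<lambda>x. cis (x * of_int k)) j = (if j = k then 1 else 0)"
    using fourier_coeff_trig_polynomial[of "{k}" "\<lambda>_. 1" j] by simp
  then show ?thesis
    unfolding L2_cis_def L2_coeff_class[OF trig_polynomial_L2[OF trig_polynomials_cis]] .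
qed

lemma scaleR_eq_scaleC_L2: "r *\<^sub>R f = scaleC_L2 (of_real r) f"
  by (rule L2_coeff_inject) (simp add: L2_coeff_scaleC L2_coeff_scaleR)

definition L2_trig :: "int set \<Rightarrow> (int \<Rightarrow> complex) \<Rightarrow> L2_circle" where
  "L2_trig S c = (\<Sum>k\<in>S. scaleC_L2 (c k) (L2_cis k))"

lemma L2_coeff_trig:
  assumes "finite S"
  shows "L2_coeff (L2_trig S c) j = (if j \<in> S then c j else 0)"
  unfolding L2_trig_def L2_coeff_sum L2_coeff_scaleC L2_coeff_cis
  using assms by (simp add: if_distrib[of "\<lambda>x. _ * x"] cong: if_cong)

lemma class_L2_trig:
  assumes "finite S"
  shows "class_L2 (\<lambda>x. \<Sum>k\<in>S. c k * cis (x * of_int k)) = L2_trig S c"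
  by (rule L2_coeff_inject)
    (simp only: L2_coeff_class[OF trig_polynomial_L2[OF trig_polynomial_sum[OF assms]]]
       fourier_coeff_trig_polynomial[OF assms] L2_coeff_trig[OF assms])

lemma norm_L2_trig:
  assumes "finite S"
  shows "(norm (L2_trig S c))\<^sup>2 = (\<Sum>k\<in>S. (cmod (c k))\<^sup>2)"
proof (rule has_sum_unique[OF parseval])
  show "((\<lambda>k. (cmod (L2_coeff (L2_trig S c) k))\<^sup>2) has_sum (\<Sum>k\<in>S. (cmod (c k))\<^sup>2)) UNIV"
    by (rule has_sum_finite_neutralI[OF assms]) (auto simp: L2_coeff_trig[OF assms])
qed

text \<open>By Parseval's identity the squared norm of the remainder is the part of the sum of squares
  outside \<open>S\<close>.\<close>

lemma fourier_series_has_sum: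
  "((\<lambda>k. scaleC_L2 (L2_coeff f k) (L2_cis k)) has_sum f) UNIV"
proof -
  have "(norm (f - L2_trig S (L2_coeff f)))\<^sup>2 = (norm f)\<^sup>2 - (\<Sum>k\<in>S. (cmod (L2_coeff f k))\<^sup>2)"
    if S: "finite S" for S
  proof -
    let ?r = "f - L2_trig S (L2_coeff f)"
    have "((\<lambda>k. (cmod (L2_coeff ?r k))\<^sup>2 + (cmod (L2_coeff (L2_trig S (L2_coeff f)) k))\<^sup>2)
        has_sum (norm ?r)\<^sup>2 + (norm (L2_trig S (L2_coeff f)))\<^sup>2) UNIV"
      by (rule has_sum_add[OF parseval parseval])
    also have "(\<lambda>k. (cmod (L2_coeff ?r k))\<^sup>2 + (cmod (L2_coeff (L2_trig S (L2_coeff f)) k))\<^sup>2)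
        = (\<lambda>k. (cmod (L2_coeff f k))\<^sup>2)"
      by (auto simp: L2_coeff_diff L2_coeff_trig[OF S])
    finally have "(norm ?r)\<^sup>2 + (norm (L2_trig S (L2_coeff f)))\<^sup>2 = (norm f)\<^sup>2"
      by (rule has_sum_unique[OF _ parseval])
    then show ?thesis by (simp add: norm_L2_trig[OF S])
  qed
  then have rest: "norm (f - L2_trig S (L2_coeff f)) = sqrt ((norm f)\<^sup>2 - (\<Sum>k\<in>S. (cmod (L2_coeff f k))\<^sup>2))"
    if "finite S" for S
    using that by (metis norm_ge_zero real_sqrt_pow2 real_sqrt_unique)
  have "((\<lambda>S. sqrt ((norm f)\<^sup>2 - (\<Sum>k\<in>S. (cmod (L2_coeff f k))\<^sup>2)))
      \<longlongrightarrow> sqrt ((norm f)\<^sup>2 - (norm f)\<^sup>2)) (finite_subsets_at_top UNIV)"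
    using parseval[of f] unfolding has_sum_def by (intro tendsto_intros)
  then have "((\<lambda>S. norm (f - L2_trig S (L2_coeff f))) \<longlongrightarrow> 0) (finite_subsets_at_top UNIV)"
    by (subst tendsto_cong[where g = "\<lambda>S. sqrt ((norm f)\<^sup>2 - (\<Sum>k\<in>S. (cmod (L2_coeff f k))\<^sup>2))"])
      (auto simp: rest intro!: eventually_finite_subsets_at_top_weakI)
  then have "((\<lambda>S. L2_trig S (L2_coeff f)) \<longlongrightarrow> f) (finite_subsets_at_top UNIV)"
    by (subst tendsto_dist_iff) (simp add: dist_norm norm_minus_commute)
  then show ?thesis
    unfolding has_sum_def L2_trig_def .
qed

lemma cmod_L2_coeff_le_norm: "cmod (L2_coeff f k) \<le> norm f"
proof -
  have "(cmod (L2_coeff f k))\<^sup>2 \<le> (norm f)\<^sup>2"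
    using bessel_inequality[of "{k}" f] by simp
  then show ?thesis by (rule power2_le_imp_le) simp
qed

lemma bounded_linear_L2_coeff: "bounded_linear (\<lambda>f. L2_coeff f k)"
  by (rule bounded_linear_intro[where K = 1])
    (simp_all add: L2_coeff_add L2_coeff_scaleR scaleR_conv_of_real cmod_L2_coeff_le_norm)

definition bounded_clinear_L2 :: "(L2_circle \<Rightarrow> L2_circle) \<Rightarrow> bool" where
  "bounded_clinear_L2 A \<longleftrightarrow> bounded_linear A \<and> (\<forall>c f. A (scaleC_L2 c f) = scaleC_L2 c (A f))"

definition matrix_of :: "(L2_circle \<Rightarrow> L2_circle) \<Rightarrow> int_matrix" where
  "matrix_of A j k = L2_coeff (A (L2_cis k)) j"

text \<open>A continuous linear operator may be applied to the Fourier series term by term.  Everything about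
  products of matrices of bounded operators reduces to this.\<close>

lemma matrix_of_apply_has_sum:
  assumes "bounded_clinear_L2 A"
  shows "((\<lambda>k. matrix_of A j k * L2_coeff f k) has_sum L2_coeff (A f) j) UNIV"
proof -
  have "bounded_linear (\<lambda>f. L2_coeff (A f) j)"
    using bounded_linear_compose[OF bounded_linear_L2_coeff] assms
    unfolding bounded_clinear_L2_def by blast
  from has_sum_bounded_linear[OF this fourier_series_has_sum[of f]]
  have "((\<lambda>k. L2_coeff (A (scaleC_L2 (L2_coeff f k) (L2_cis k))) j) has_sum L2_coeff (A f) j) UNIV" .
  then show ?thesis
    using assms by (simp add: bounded_clinear_L2_def L2_coeff_scaleC matrix_of_def mult.commute)
qed

lemma bounded_clinear_L2_eqI:
  assumes "bounded_clinear_L2 A" "bounded_clinear_L2 B" "matrix_of A = matrix_of B"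
  shows "A = B"
proof
  fix f
  show "A f = B f"
    using has_sum_unique[OF matrix_of_apply_has_sum[OF assms(1)]] matrix_of_apply_has_sum[OF assms(2)]
    by (intro L2_coeff_inject) (simp add: assms(3))
qed

lemma bounded_clinear_L2_comp:
  "bounded_clinear_L2 A \<Longrightarrow> bounded_clinear_L2 B \<Longrightarrow> bounded_clinear_L2 (A \<circ> B)"
  using bounded_linear_compose unfolding bounded_clinear_L2_def comp_def by auto

lemma bounded_clinear_L2_funpow:
  assumes "bounded_clinear_L2 A"
  shows "bounded_clinear_L2 (A ^^ n)"
proof (induction n)
  case 0
  show ?case by (simp add: bounded_clinear_L2_def id_def bounded_linear_ident)
next
  case (Suc n)
  show ?case unfolding funpow.simps by (rule bounded_clinear_L2_comp[OF assms Suc])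
qed

lemma matrix_of_comp_has_sum:
  assumes "bounded_clinear_L2 A"
  shows "((\<lambda>h. matrix_of A j h * matrix_of B h k) has_sum matrix_of (A \<circ> B) j k) UNIV"
  using matrix_of_apply_has_sum[OF assms, of j "B (L2_cis k)"] by (simp add: matrix_of_def)

lemma mat_mult_matrix_of:
  assumes "bounded_clinear_L2 A"
  shows "mat_mult_defined (matrix_of A) (matrix_of B)"
    and "mat_mult (matrix_of A) (matrix_of B) = matrix_of (A \<circ> B)"
  using matrix_of_comp_has_sum[OF assms] 
  by (auto simp: mat_mult_defined_def mat_mult_def fun_eq_iff
      intro!: infsumI intro: has_sum_imp_summable)

lemma mat_pow_matrix_of:
  assumes "bounded_clinear_L2 A"
  shows "mat_pow (matrix_of A) n = matrix_of (A ^^ n)"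
proof (induction n)
  case 0
  show ?case by (auto simp: matrix_of_def L2_coeff_cis fun_eq_iff)
next
  case (Suc n)
  show ?case
    unfolding mat_pow.simps Suc mat_mult_matrix_of(2)[OF bounded_clinear_L2_funpow[OF assms]]
      funpow_Suc_right ..
qed

text \<open>For matrices of bounded operators, independence of the bracketing is the associativity of
  composition.\<close>

lemma mat_pow_defined_matrix_of:
  assumes "bounded_clinear_L2 A"
  shows "mat_pow_defined (matrix_of A) n"
  unfolding mat_pow_defined_def mat_pow_matrix_of[OF assms] funpow_add
  using mat_mult_matrix_of[OF bounded_clinear_L2_funpow[OF assms]] by blast

text \<open>An operator may be prescribed by the Fourier coefficients of its values: Riesz-Fischer provides the
  values, and uniqueness of coefficients makes the choice linear.\<close>

lemma bounded_clinear_L2_from_coeffs: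
  assumes add: "\<And>f g k. T (f + g) k = T f k + T g k"
    and scale: "\<And>c f k. T (scaleC_L2 c f) k = c * T f k"
    and bound: "\<And>f S. finite S \<Longrightarrow> (\<Sum>k\<in>S. (cmod (T f k))\<^sup>2) \<le> (B * norm f)\<^sup>2"
    and "B \<ge> 0"
  obtains A where "bounded_clinear_L2 A" "\<And>f k. L2_coeff (A f) k = T f k"
    "\<And>f. norm (A f) \<le> B * norm f"
proof -
  have "\<exists>g. (\<forall>k. L2_coeff g k = T f k) \<and> norm g \<le> B * norm f" for f
  proof -
    have T: "square_summable (T f)" by (rule square_summableI) (rule bound)
    obtain g where g: "L2_coeff g = T f" "(norm g)\<^sup>2 \<le> (\<Sum>\<^sub>\<infinity>k. (cmod (T f k))\<^sup>2)"
      using L2_coeff_exists[OF T] .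
    have "(\<Sum>\<^sub>\<infinity>k. (cmod (T f k))\<^sup>2) \<le> (B * norm f)\<^sup>2"
      by (rule infsum_le_finite_sums) (use T bound in \<open>auto simp: square_summable_def\<close>)
    with g(2) have "(norm g)\<^sup>2 \<le> (B * norm f)\<^sup>2" by linarith
    then have "norm g \<le> B * norm f"
      by (rule power2_le_imp_le) (use \<open>B \<ge> 0\<close> in simp)
    then show ?thesis using g(1) by (intro exI[of _ g]) simp
  qed
  then obtain A where A: "\<And>f k. L2_coeff (A f) k = T f k" "\<And>f. norm (A f) \<le> B * norm f"
    by metis
  have scaleC: "A (scaleC_L2 c f) = scaleC_L2 c (A f)" for c f
    by (rule L2_coeff_inject) (simp add: A L2_coeff_scaleC scale)
  have "bounded_linear A"
  proof (rule bounded_linear_intro[where K = B])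
    show "A (f + g) = A f + A g" for f g
      by (rule L2_coeff_inject) (simp add: A L2_coeff_add add)
    show "A (r *\<^sub>R f) = r *\<^sub>R A f" for r f
      by (simp only: scaleR_eq_scaleC_L2 scaleC)
    show "norm (A f) \<le> norm f * B" for f
      using A(2)[of f] by (simp add: mult.commute)
  qed
  with scaleC A show ?thesis using that unfolding bounded_clinear_L2_def by blast
qed

lemma matrix_of_column_square_summable: "square_summable (\<lambda>j. matrix_of A j k)"
  unfolding matrix_of_def by (rule square_summable_L2_coeff)

lemma L2_coeff_apply_trig:
  assumes "bounded_clinear_L2 A" "finite S"
  shows "L2_coeff (A (L2_trig S c)) j = (\<Sum>k\<in>S. matrix_of A j k * c k)"
proof -
  interpret bounded_linear A using assms by (simp add: bounded_clinear_L2_def)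
  show ?thesis
    using assms(1)
    by (simp add: L2_trig_def sum L2_coeff_sum bounded_clinear_L2_def L2_coeff_scaleC matrix_of_def mult.commute)
qed

text \<open>Testing \<open>A\<close> on the vector of conjugates of a finite part of the row gives \<open>X \<le> \<parallel>A\<parallel> X\<^sup>1\<^sup>/\<^sup>2\<close> for its
  sum of squares \<open>X\<close>.\<close>

lemma matrix_of_row_square_summable:
  assumes A: "bounded_clinear_L2 A"
  shows "square_summable (\<lambda>k. matrix_of A j k)"
proof (rule square_summableI)
  fix S :: "int set" assume S: "finite S"
  define X where "X = (\<Sum>k\<in>S. (cmod (matrix_of A j k))\<^sup>2)"
  define g where "g = L2_trig S (\<lambda>k. cnj (matrix_of A j k))"
  have "X \<ge> 0" unfolding X_def by (intro sum_nonneg) simp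
  have g: "(norm g)\<^sup>2 = X" by (simp add: g_def X_def norm_L2_trig[OF S])
  have "L2_coeff (A g) j = of_real X"
    unfolding g_def L2_coeff_apply_trig[OF A S] X_def of_real_sum
    by (simp add: complex_norm_square del: of_real_power)
  then have "X \<le> norm (A g)"
    using cmod_L2_coeff_le_norm[of "A g" j] \<open>X \<ge> 0\<close> by simp
  also have "\<dots> \<le> onorm A * norm g"
    using A by (intro onorm) (simp add: bounded_clinear_L2_def)
  finally have "X\<^sup>2 \<le> (onorm A * norm g)\<^sup>2"
    using \<open>X \<ge> 0\<close> by (intro power_mono) auto
  then have "X * X \<le> (onorm A)\<^sup>2 * X"
    by (simp add: power_mult_distrib g power2_eq_square[of X])
  then have "X \<le> (onorm A)\<^sup>2"
    using \<open>X \<ge> 0\<close> by (cases "X = 0") auto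
  then show "(\<Sum>k\<in>S. (cmod (matrix_of A j k))\<^sup>2) \<le> (onorm A)\<^sup>2"
    by (simp add: X_def)
qed

text \<open>The operator \<open>D\<close> is \<open>A\<^sup>* A\<close>, prescribed by its coefficients \<open>T f j = \<langle>A f, A e\<^sub>j\<rangle>\<close>, where \<open>e\<^sub>j\<close> are the
  exponentials; the inner product is computed in coefficients.  For \<open>X\<close> the sum of \<open>\<bar>T f k\<bar>\<^sup>2\<close> over
  \<open>S\<close> and \<open>g\<close> the trigonometric polynomial with coefficients \<open>T f k\<close> one has \<open>X = \<langle>A f, A g\<rangle>\<close>
  and \<open>\<parallel>g\<parallel>\<^sup>2 = X\<close>, which bounds \<open>X\<close>.\<close>

lemma gram_operator:
  assumes A: "bounded_clinear_L2 A"
  obtains D where "bounded_clinear_L2 D"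
    "matrix_of D = mat_mult (mat_adj (matrix_of A)) (matrix_of A)"
    "\<And>f. norm (D f) \<le> (onorm A)\<^sup>2 * norm f"
proof -
  have lin: "bounded_linear A" using A by (simp add: bounded_clinear_L2_def)
  interpret bounded_linear A by (rule lin)
  define T where "T f j = (\<Sum>\<^sub>\<infinity>h. cnj (matrix_of A h j) * L2_coeff (A f) h)" for f j
  have smb: "(\<lambda>h. cnj (matrix_of A h j) * L2_coeff (A f) h) summable_on UNIV" for f j
    by (intro square_summable_mult square_summable_cnj[THEN iffD2] matrix_of_column_square_summable
        square_summable_L2_coeff)
  show ?thesis
  proof (rule bounded_clinear_L2_from_coeffs[of T "(onorm A)\<^sup>2"])
    show "T (f + g) k = T f k + T g k" for f g k
      unfolding T_def add L2_coeff_add distrib_left by (rule infsum_add) (rule smb)+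
    show "T (scaleC_L2 c f) k = c * T f k" for c f k
      using A unfolding T_def
      by (simp add: bounded_clinear_L2_def L2_coeff_scaleC mult.left_commute infsum_cmult_right')
    show "(\<Sum>k\<in>S. (cmod (T f k))\<^sup>2) \<le> ((onorm A)\<^sup>2 * norm f)\<^sup>2" if S: "finite S" for f S
    proof -
      define X where "X = (\<Sum>k\<in>S. (cmod (T f k))\<^sup>2)"
      define g where "g = L2_trig S (T f)"
      have "X \<ge> 0" unfolding X_def by (intro sum_nonneg) simp
      have g: "(norm g)\<^sup>2 = X" by (simp add: g_def X_def norm_L2_trig[OF S])
      have "((\<lambda>h. \<Sum>k\<in>S. cnj (T f k) * (cnj (matrix_of A h k) * L2_coeff (A f) h)) has_sum
          (\<Sum>k\<in>S. cnj (T f k) * T f k)) UNIV"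
        unfolding T_def by (intro has_sum_finite_sum has_sum_cmult_right has_sum_infsum smb)
      also have "(\<lambda>h. \<Sum>k\<in>S. cnj (T f k) * (cnj (matrix_of A h k) * L2_coeff (A f) h))
          = (\<lambda>h. cnj (L2_coeff (A g) h) * L2_coeff (A f) h)"
        unfolding g_def L2_coeff_apply_trig[OF A S] cnj_sum sum_distrib_right
        by (intro ext sum.cong refl) (simp add: mult_ac)
      also have "(\<Sum>k\<in>S. cnj (T f k) * T f k) = of_real X"
        by (simp only: X_def of_real_sum mult_cnj_eq_norm_square)
      finally have "(\<Sum>\<^sub>\<infinity>h. cnj (L2_coeff (A g) h) * L2_coeff (A f) h) = of_real X"
        by (rule infsumI)
      moreover have "(cmod (\<Sum>\<^sub>\<infinity>h. cnj (L2_coeff (A g) h) * L2_coeff (A f) h))\<^sup>2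
          \<le> (\<Sum>\<^sub>\<infinity>h. (cmod (cnj (L2_coeff (A g) h)))\<^sup>2) * (\<Sum>\<^sub>\<infinity>h. (cmod (L2_coeff (A f) h))\<^sup>2)"
        by (intro infsum_Cauchy_Schwarz square_summable_L2_coeff square_summable_cnj[THEN iffD2])
      ultimately have "X\<^sup>2 \<le> (norm (A g))\<^sup>2 * (norm (A f))\<^sup>2"
        using \<open>X \<ge> 0\<close> by (simp add: infsumI[OF parseval])
      also have "\<dots> \<le> (onorm A * norm g)\<^sup>2 * (onorm A * norm f)\<^sup>2"
        by (intro mult_mono power_mono onorm[OF lin]) auto
      also have "\<dots> = ((onorm A)\<^sup>2 * norm f)\<^sup>2 * X"
        by (simp add: power_mult_distrib g[symmetric] power2_eq_square mult_ac)
      finally have "X * X \<le> ((onorm A)\<^sup>2 * norm f)\<^sup>2 * X"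
        by (simp only: power2_eq_square[of X])
      then have "X \<le> ((onorm A)\<^sup>2 * norm f)\<^sup>2"
        using \<open>X \<ge> 0\<close> by (cases "X = 0") auto
      then show ?thesis by (simp add: X_def)
    qed
    fix D
    assume D: "bounded_clinear_L2 D" "\<And>f k. L2_coeff (D f) k = T f k"
      "\<And>f. norm (D f) \<le> (onorm A)\<^sup>2 * norm f"
    have "matrix_of D j k = mat_mult (mat_adj (matrix_of A)) (matrix_of A) j k" for j k
      unfolding mat_mult_def mat_adj_def by (simp add: matrix_of_def[of D] D(2) T_def matrix_of_def[of A])
    then show thesis using that D by blast
  qed simp
qed

text \<open>Square-summable rows make \<open>M\<close> applicable to every square-summable sequence; the bound on finite
  sections carries over to the limit.\<close>

lemma operator_from_matrix:
  fixes M :: int_matrix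
  assumes rows: "\<And>j. square_summable (\<lambda>k. M j k)" and "B \<ge> 0"
    and bound: "\<And>S F v. finite S \<Longrightarrow> finite F \<Longrightarrow>
      (\<Sum>j\<in>S. (cmod (\<Sum>k\<in>F. M j k * v k))\<^sup>2) \<le> B\<^sup>2 * (\<Sum>k\<in>F. (cmod (v k))\<^sup>2)"
  obtains A where "bounded_clinear_L2 A" "matrix_of A = M" "\<And>f. norm (A f) \<le> B * norm f"
proof -
  define T where "T f j = (\<Sum>\<^sub>\<infinity>k. M j k * L2_coeff f k)" for f j
  have smb: "(\<lambda>k. M j k * L2_coeff f k) summable_on UNIV" for f j
    by (intro square_summable_mult rows square_summable_L2_coeff)
  show ?thesis
  proof (rule bounded_clinear_L2_from_coeffs[of T B])
    show "T (f + g) k = T f k + T g k" for f g k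
      unfolding T_def L2_coeff_add distrib_left by (rule infsum_add) (rule smb)+
    show "T (scaleC_L2 c f) k = c * T f k" for c f k
      unfolding T_def by (simp add: L2_coeff_scaleC mult.left_commute infsum_cmult_right')
    show "(\<Sum>j\<in>S. (cmod (T f j))\<^sup>2) \<le> (B * norm f)\<^sup>2" if S: "finite S" for f S
    proof (rule tendsto_upperbound)
      show "((\<lambda>F. \<Sum>j\<in>S. (cmod (\<Sum>k\<in>F. M j k * L2_coeff f k))\<^sup>2) \<longlongrightarrow> (\<Sum>j\<in>S. (cmod (T f j))\<^sup>2))
          (finite_subsets_at_top UNIV)"
        using has_sum_infsum[OF smb] unfolding has_sum_def T_def by (intro tendsto_intros)
      show "\<forall>\<^sub>F F in finite_subsets_at_top UNIV.
          (\<Sum>j\<in>S. (cmod (\<Sum>k\<in>F. M j k * L2_coeff f k))\<^sup>2) \<le> (B * norm f)\<^sup>2"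
      proof (rule eventually_finite_subsets_at_top_weakI)
        fix F :: "int set" assume F: "finite F"
        have "(\<Sum>j\<in>S. (cmod (\<Sum>k\<in>F. M j k * L2_coeff f k))\<^sup>2) \<le> B\<^sup>2 * (\<Sum>k\<in>F. (cmod (L2_coeff f k))\<^sup>2)"
          by (rule bound[OF S F])
        also have "\<dots> \<le> B\<^sup>2 * (norm f)\<^sup>2"
          by (intro mult_left_mono bessel_inequality F) simp
        finally show "(\<Sum>j\<in>S. (cmod (\<Sum>k\<in>F. M j k * L2_coeff f k))\<^sup>2) \<le> (B * norm f)\<^sup>2"
          by (simp add: power_mult_distrib)
      qed
    qed simp
    show "B \<ge> 0" by fact
    fix A
    assume A: "bounded_clinear_L2 A" "\<And>f k. L2_coeff (A f) k = T f k" "\<And>f. norm (A f) \<le> B * norm f"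
    have "matrix_of A j k = M j k" for j k
      unfolding matrix_of_def A(2) T_def L2_coeff_cis
      by (rule infsumI, rule has_sum_finite_neutralI[of "{k}"]) auto
    then show thesis using that A by blast
  qed
qed

section \<open>Symbols and their matrices\<close>

lemma L2_mult_cis:
  assumes "f \<in> L2_functions"
  shows "(\<lambda>x. f x * cis (x * of_int k)) \<in> L2_functions"
  using assms by (auto simp: L2_functions_def norm_mult)

lemma fourier_coeff_mult_cis:
  "fourier_coeff (\<lambda>x. f x * cis (x * of_int k)) j = fourier_coeff f (j - k)"
proof -
  have "f x * cis (x * of_int k) * cis (- (x * of_int j)) = f x * cis (- (x * of_int (j - k)))" for x
    by (simp add: mult.assoc cis_mult algebra_simps)
  then show ?thesis by (simp only: fourier_coeff_def)
qed

lemma pseudo_diff_op_trig: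
  assumes S: "finite S"
  shows "pseudo_diff_op \<sigma> (\<lambda>x. \<Sum>k\<in>S. c k * cis (x * of_int k))
    = (\<lambda>x. \<Sum>k\<in>S. c k * (\<sigma> x k * cis (x * of_int k)))"
  unfolding pseudo_diff_op_def fourier_coeff_trig_polynomial[OF S]
  by (intro ext infsumI has_sum_finite_neutralI[OF S]) (auto intro!: sum.cong)

locale symbol_columns =
  fixes \<sigma> :: "real \<Rightarrow> int \<Rightarrow> complex"
  assumes L2: "\<And>k. (\<lambda>x. \<sigma> x k) \<in> L2_functions"
begin

lemma L2_coeff_pseudo_diff_op:
  assumes S: "finite S"
  shows "L2_coeff (class_L2 (pseudo_diff_op \<sigma> (\<lambda>x. \<Sum>k\<in>S. c k * cis (x * of_int k)))) j
    = (\<Sum>k\<in>S. symbol_matrix \<sigma> j k * c k)"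
proof -
  let ?g = "\<lambda>k x. c k * (\<sigma> x k * cis (x * of_int k))"
  have g: "?g k \<in> L2_functions" for k
    by (intro L2_cmult L2_mult_cis L2)
  have "(\<lambda>x. \<Sum>k\<in>S. ?g k x) \<in> L2_functions"
    by (induction S rule: infinite_finite_induct) (auto intro: L2_zero L2_add g)
  then have "L2_coeff (class_L2 (\<lambda>x. \<Sum>k\<in>S. ?g k x)) j = fourier_coeff (\<lambda>x. \<Sum>k\<in>S. ?g k x) j"
    by (simp only: L2_coeff_class)
  also have "\<dots> = (\<Sum>k\<in>S. fourier_coeff (?g k) j)"
    unfolding fourier_coeff_def sum_distrib_right
    by (rule Bochner_Integration.integral_sum) (rule L2_integrable_cis[OF g])
  also have "\<dots> = (\<Sum>k\<in>S. symbol_matrix \<sigma> j k * c k)"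
  proof (rule sum.cong[OF refl])
    fix k
    have "fourier_coeff (?g k) j = c k * fourier_coeff (\<lambda>x. \<sigma> x k * cis (x * of_int k)) j"
      by (simp add: fourier_coeff_def mult.assoc)
    then show "fourier_coeff (?g k) j = symbol_matrix \<sigma> j k * c k"
      by (simp only: fourier_coeff_mult_cis symbol_matrix_def mult.commute)
  qed
  finally show ?thesis
    unfolding pseudo_diff_op_trig[OF S] .
qed

lemma symbol_matrix_column_square_summable: "square_summable (\<lambda>j. symbol_matrix \<sigma> j k)"
proof -
  have "symbol_matrix \<sigma> j k = L2_coeff (class_L2 (\<lambda>x. \<sigma> x k * cis (x * of_int k))) j" for j
    by (simp only: L2_coeff_class[OF L2_mult_cis[OF L2]] fourier_coeff_mult_cis symbol_matrix_def)
  then show ?thesis by (simp only: square_summable_L2_coeff)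
qed

text \<open>On trigonometric polynomials the operator is determined by its values on the exponentials, where
  its coefficients are the columns of the symbol matrix.\<close>

lemma bounded_extension_iff:
  "bounded_extension \<sigma> A \<longleftrightarrow> bounded_clinear_L2 A \<and> matrix_of A = symbol_matrix \<sigma>"
proof
  assume A: "bounded_extension \<sigma> A"
  have "matrix_of A j k = symbol_matrix \<sigma> j k" for j k
  proof -
    have "A (class_L2 (\<lambda>x. cis (x * of_int k))) = class_L2 (pseudo_diff_op \<sigma> (\<lambda>x. cis (x * of_int k)))"
      using A trig_polynomials_cis unfolding bounded_extension_def by blast
    then show ?thesis
      using L2_coeff_pseudo_diff_op[of "{k}" "\<lambda>_. 1" j] by (simp add: matrix_of_def L2_cis_def)
  qed
  then show "bounded_clinear_L2 A \<and> matrix_of A = symbol_matrix \<sigma>"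
    using A by (auto simp: bounded_extension_def bounded_clinear_L2_def)
next
  assume A: "bounded_clinear_L2 A \<and> matrix_of A = symbol_matrix \<sigma>"
  have "A (class_L2 f) = class_L2 (pseudo_diff_op \<sigma> f)" if "f \<in> trig_polynomials" for f
  proof -
    from that obtain S c where S: "finite S" and f: "f = (\<lambda>x. \<Sum>k\<in>S. c k * cis (x * of_int k))"
      by (auto simp: trig_polynomials_def)
    show ?thesis
      unfolding f class_L2_trig[OF S]
      by (rule L2_coeff_inject) (use A S in \<open>simp add: L2_coeff_apply_trig L2_coeff_pseudo_diff_op\<close>)
  qed
  then show "bounded_extension \<sigma> A"
    using A by (simp add: bounded_extension_def bounded_clinear_L2_def)
qed

lemma gram_matrix_has_sum:
  "((\<lambda>h. cnj (symbol_matrix \<sigma> h j) * symbol_matrix \<sigma> h k) has_sum gram_matrix \<sigma> j k) UNIV"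
  unfolding gram_matrix_def mat_mult_def mat_adj_def
  by (intro has_sum_infsum square_summable_mult square_summable_cnj[THEN iffD2]
      symbol_matrix_column_square_summable)

lemma gram_matrix_hermitian: "mat_adj (gram_matrix \<sigma>) = gram_matrix \<sigma>"
proof -
  have "cnj (gram_matrix \<sigma> k j) = gram_matrix \<sigma> j k" for j k
  proof (rule has_sum_unique)
    show "((\<lambda>h. cnj (symbol_matrix \<sigma> h j) * symbol_matrix \<sigma> h k) has_sum gram_matrix \<sigma> j k) UNIV"
      by (rule gram_matrix_has_sum)
    show "((\<lambda>h. cnj (symbol_matrix \<sigma> h j) * symbol_matrix \<sigma> h k) has_sum cnj (gram_matrix \<sigma> k j)) UNIV"
      using has_sum_cnj_iff[THEN iffD2, OF gram_matrix_has_sum[of k j]]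
      by (simp add: mult.commute del: has_sum_cnj_iff)
  qed
  then show ?thesis by (simp add: mat_adj_def fun_eq_iff)
qed

end

text \<open>The Riesz-Fischer theorem applied to each column gives the symbol; joint measurability is automatic
  since the second variable is discrete.\<close>

lemma matrix_symbol_exists:
  assumes "\<And>k. square_summable (\<lambda>j. P j k)"
  shows "is_symbol (matrix_symbol P) \<and> symbol_matrix (matrix_symbol P) = P"
proof -
  have "\<exists>f. f \<in> L2_functions \<and> (\<forall>j. fourier_coeff f j = P j k)" for k
    using riesz_fischer[of "\<lambda>j. P j k"] assms[of k] unfolding square_summable_def by metis
  then obtain f where f: "\<And>k. f k \<in> L2_functions" "\<And>j k. fourier_coeff (f k) j = P j k"
    by metis
  define \<tau> where "\<tau> x k = f k x * cis (x * of_int (- k))" for x k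
  have L2: "(\<lambda>x. \<tau> x k) \<in> L2_functions" for k
    unfolding \<tau>_def by (rule L2_mult_cis[OF f(1)])
  have "(\<lambda>p. \<tau> (fst p) (snd p)) \<in> borel_measurable (circle \<Otimes>\<^sub>M count_space UNIV)"
  proof (rule measurable_compose_countable'[where f = "\<lambda>k p. \<tau> (fst p) k" and g = snd and I = UNIV])
    fix k
    have "(\<lambda>x. \<tau> x k) \<in> borel_measurable circle"
      using L2[of k] by (simp add: L2_functions_def)
    then show "(\<lambda>p. \<tau> (fst p) k) \<in> borel_measurable (circle \<Otimes>\<^sub>M count_space UNIV)"
      by (rule measurable_compose[OF measurable_fst])
  qed auto
  then have "is_symbol \<tau>"
    using L2 by (simp add: is_symbol_def case_prod_beta)
  moreover have "symbol_matrix \<tau> j k = P j k" for j k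
    unfolding symbol_matrix_def \<tau>_def fourier_coeff_mult_cis f(2) by simp
  ultimately have "\<exists>\<tau>. is_symbol \<tau> \<and> symbol_matrix \<tau> = P"
    by (intro exI[of _ \<tau>]) (simp add: fun_eq_iff)
  then show ?thesis
    unfolding matrix_symbol_def by (rule someI_ex)
qed

text \<open>The mean value is the Fourier coefficient of order zero, which sits on the diagonal.\<close>

lemma integral_matrix_symbol:
  assumes "\<And>k. square_summable (\<lambda>j. P j k)"
  shows "(\<integral>x. matrix_symbol P x k \<partial>circle) = P k k"
proof -
  have "symbol_matrix (matrix_symbol P) k k = P k k"
    using matrix_symbol_exists[OF assms] by simp
  then show ?thesis by (simp add: symbol_matrix_def fourier_coeff_def)
qed

lemma tau_sup_eq_diagonal:
  assumes "\<And>n k. n \<ge> 1 \<Longrightarrow> square_summable (\<lambda>j. mat_pow (gram_matrix \<sigma>) n j k)"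
  shows "tau_sup \<sigma> = (SUP n\<in>{1..}. SUP k. ereal (cmod (mat_pow (gram_matrix \<sigma>) n k k) powr (1 / real n)))"
  unfolding tau_sup_def tau_pow_def
  by (intro SUP_cong refl arg_cong[where f = ereal] arg_cong[where f = "\<lambda>z. cmod z powr _"]
      integral_matrix_symbol assms) simp

lemma root_powr_le_iff:
  fixes a C :: real
  assumes "a \<ge> 0" "C \<ge> 0" "n \<ge> 1"
  shows "a powr (1 / real n) \<le> C \<longleftrightarrow> a \<le> C ^ n"
proof -
  have "(a powr (1 / real n)) ^ n = a"
  proof (cases "a = 0")
    case False
    then show ?thesis using assms by (simp add: powr_realpow[symmetric] powr_powr)
  qed (use assms in simp)
  then show ?thesis
    using power_mono_iff[of "a powr (1 / real n)" C n] assms by simp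
qed

lemma tau_sup_le_iff:
  assumes "\<And>n k. n \<ge> 1 \<Longrightarrow> square_summable (\<lambda>j. mat_pow (gram_matrix \<sigma>) n j k)" and "C \<ge> 0"
  shows "tau_sup \<sigma> \<le> ereal C \<longleftrightarrow> (\<forall>n\<ge>1. \<forall>k. cmod (mat_pow (gram_matrix \<sigma>) n k k) \<le> C ^ n)"
  unfolding tau_sup_eq_diagonal[OF assms(1), simplified] SUP_le_iff
  using \<open>C \<ge> 0\<close> by (auto simp: root_powr_le_iff)

lemma tau_sup_nonneg: "tau_sup \<sigma> \<ge> 0"
proof -
  have "0 \<le> ereal (cmod (\<integral>x. tau_pow \<sigma> 1 x 0 \<partial>circle) powr (1 / real 1))" by simp
  also have "\<dots> \<le> tau_sup \<sigma>"
    unfolding tau_sup_def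
    by (rule SUP_upper2[where i = 1], simp, rule SUP_upper2[where i = 0]) simp_all
  finally show ?thesis .
qed

section \<open>Boundedness of the operator\<close>

context symbol_columns begin

lemma bounded_extension_from_growth:
  assumes rows: "\<And>j. square_summable (\<lambda>k. symbol_matrix \<sigma> j k)"
    and powers: "\<And>n. n \<ge> 1 \<Longrightarrow> mat_pow_defined (gram_matrix \<sigma>) n"
    and sup: "tau_sup \<sigma> \<le> ereal C" and "C \<ge> 0"
  obtains A where "bounded_extension \<sigma> A" "\<And>f. norm (A f) \<le> sqrt C * norm f"
proof -
  interpret G: hermitian_with_powers "gram_matrix \<sigma>"
    by standard (rule gram_matrix_hermitian, rule powers)
  have diag: "cmod (mat_pow (gram_matrix \<sigma>) n k k) \<le> C ^ n" if "n \<ge> 1" for n k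
    using sup that tau_sup_le_iff[OF G.mat_pow_column_square_summable \<open>C \<ge> 0\<close>] by blast
  have bound: "(\<Sum>j\<in>S. (cmod (\<Sum>k\<in>F. symbol_matrix \<sigma> j k * v k))\<^sup>2) \<le> (sqrt C)\<^sup>2 * (\<Sum>k\<in>F. (cmod (v k))\<^sup>2)"
    if S: "finite S" and F: "finite F" for S F v
  proof -
    \<comment> \<open>The form of the Gram matrix at \<open>v\<close> is the squared norm of the image of \<open>v\<close>.\<close>
    let ?Q = "\<Sum>j\<in>F. \<Sum>k\<in>F. cnj (v j) * gram_matrix \<sigma> j k * v k"
    have "((\<lambda>h. complex_of_real ((cmod (\<Sum>k\<in>F. symbol_matrix \<sigma> h k * v k))\<^sup>2)) has_sum ?Q) UNIV"
      by (intro quadratic_form_of_gram_entries gram_matrix_has_sum)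
    from has_sum_Re[OF this]
    have "((\<lambda>h. (cmod (\<Sum>k\<in>F. symbol_matrix \<sigma> h k * v k))\<^sup>2) has_sum Re ?Q) UNIV"
      by (simp only: Re_complex_of_real)
    then have "(\<Sum>j\<in>S. (cmod (\<Sum>k\<in>F. symbol_matrix \<sigma> j k * v k))\<^sup>2) \<le> Re ?Q"
      by (rule finite_sum_le_has_sum) (use S in auto)
    also have "\<dots> \<le> cmod ?Q" by (rule complex_Re_le_cmod)
    also have "\<dots> \<le> C * (\<Sum>k\<in>F. (cmod (v k))\<^sup>2)"
      by (rule G.quadratic_form_le_of_diagonal_growth[OF diag \<open>C \<ge> 0\<close> F])
    finally show ?thesis using \<open>C \<ge> 0\<close> by simp
  qed
  obtain A where "bounded_clinear_L2 A" "matrix_of A = symbol_matrix \<sigma>" "\<And>f. norm (A f) \<le> sqrt C * norm f"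
    using operator_from_matrix[OF rows _ bound] \<open>C \<ge> 0\<close> by auto
  then show ?thesis using that bounded_extension_iff by blast
qed

lemma bounded_extension_necessary:
  assumes A: "bounded_extension \<sigma> A"
  shows "square_summable (\<lambda>k. symbol_matrix \<sigma> j k)"
    and "mat_pow_defined (gram_matrix \<sigma>) n"
    and "tau_sup \<sigma> \<le> ereal ((onorm A)\<^sup>2)"
proof -
  have A': "bounded_clinear_L2 A" and M: "matrix_of A = symbol_matrix \<sigma>"
    using A bounded_extension_iff by auto
  show "square_summable (\<lambda>k. symbol_matrix \<sigma> j k)"
    using matrix_of_row_square_summable[OF A', of j] by (simp only: M)
  obtain D where D: "bounded_clinear_L2 D" "matrix_of D = gram_matrix \<sigma>"
    "\<And>f. norm (D f) \<le> (onorm A)\<^sup>2 * norm f"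
    using gram_operator[OF A'] unfolding M gram_matrix_def by blast
  show "mat_pow_defined (gram_matrix \<sigma>) n"
    using mat_pow_defined_matrix_of[OF D(1)] by (simp only: D(2))
  have pow: "mat_pow (gram_matrix \<sigma>) n = matrix_of (D ^^ n)" for n
    using mat_pow_matrix_of[OF D(1)] by (simp only: D(2))
  have norm_pow: "norm ((D ^^ n) f) \<le> ((onorm A)\<^sup>2) ^ n * norm f" for n f
  proof (induction n)
    case (Suc n)
    have "norm (D ((D ^^ n) f)) \<le> (onorm A)\<^sup>2 * norm ((D ^^ n) f)" by (rule D(3))
    also have "\<dots> \<le> (onorm A)\<^sup>2 * (((onorm A)\<^sup>2) ^ n * norm f)"
      by (rule mult_left_mono[OF Suc]) simp
    finally show ?case by (simp add: mult.assoc)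
  qed simp
  have "norm (L2_cis k) = 1" for k
  proof -
    have "(norm (L2_cis k))\<^sup>2 = 1\<^sup>2"
      using norm_L2_trig[of "{k}" "\<lambda>_. 1"] class_L2_trig[of "{k}" "\<lambda>_. 1"] by (simp add: L2_cis_def)
    then show ?thesis by (simp only: power2_eq_iff_nonneg[OF norm_ge_zero zero_le_one])
  qed
  then have "cmod (mat_pow (gram_matrix \<sigma>) n k k) \<le> ((onorm A)\<^sup>2) ^ n" for n k
    using order.trans[OF cmod_L2_coeff_le_norm norm_pow, of n "L2_cis k" k]
    by (simp add: pow matrix_of_def)
  moreover have "square_summable (\<lambda>j. mat_pow (gram_matrix \<sigma>) n j k)" for n k
    unfolding pow by (rule matrix_of_column_square_summable)
  ultimately show "tau_sup \<sigma> \<le> ereal ((onorm A)\<^sup>2)"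
    by (subst tau_sup_le_iff) auto
qed

end

theorem theorem3p1:
  fixes \<sigma> :: "real \<Rightarrow> int \<Rightarrow> complex"
  assumes "(\<lambda>(x, k). \<sigma> x k) \<in> borel_measurable (circle \<Otimes>\<^sub>M count_space UNIV)"
    and "\<And>k. (\<lambda>x. \<sigma> x k) \<in> L2_functions"
  shows "((\<exists>A. bounded_extension \<sigma> A) \<longleftrightarrow>
            (\<forall>j. (\<lambda>k. (cmod (symbol_matrix \<sigma> j k))\<^sup>2) summable_on UNIV) \<and>
            mat_mult_defined (mat_adj (symbol_matrix \<sigma>)) (symbol_matrix \<sigma>) \<and>
            (\<forall>n\<ge>1. mat_pow_defined (gram_matrix \<sigma>) n) \<and>
            tau_sup \<sigma> < \<infinity>) \<and>
         (\<forall>A. bounded_extension \<sigma> A \<longrightarrow> tau_sup \<sigma> = ereal ((onorm A)\<^sup>2))"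
proof -
  interpret symbol_columns \<sigma>
    by standard (rule assms(2))
  have fin: "\<exists>C\<ge>0. tau_sup \<sigma> = ereal C" if "tau_sup \<sigma> < \<infinity>"
    using that tau_sup_nonneg[of \<sigma>] by (cases "tau_sup \<sigma>") auto
  have gram_defined: "mat_mult_defined (mat_adj (symbol_matrix \<sigma>)) (symbol_matrix \<sigma>)"
    using gram_matrix_has_sum has_sum_imp_summable
    unfolding mat_mult_defined_def mat_adj_def by blast
  have finite_sup: "tau_sup \<sigma> < \<infinity>" if "bounded_extension \<sigma> A" for A
    using bounded_extension_necessary(3)[OF that] by (cases "tau_sup \<sigma>") auto
  have eq: "tau_sup \<sigma> = ereal ((onorm A)\<^sup>2)" if A: "bounded_extension \<sigma> A" for A
  proof -
    obtain C where C: "C \<ge> 0" "tau_sup \<sigma> = ereal C"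
      using fin[OF finite_sup[OF A]] by blast
    obtain A' where A': "bounded_extension \<sigma> A'" "\<And>f. norm (A' f) \<le> sqrt C * norm f"
      using bounded_extension_from_growth[OF bounded_extension_necessary(1)[OF A] bounded_extension_necessary(2)[OF A], of C] C by auto
    \<comment> \<open>The operator of norm at most the root of \<open>C\<close> is the given one, as both have the same matrix.\<close>
    have "A' = A"
      using A A'(1) unfolding bounded_extension_iff by (auto intro: bounded_clinear_L2_eqI)
    then have "onorm A \<le> sqrt C"
      using A'(2) C(1) by (intro onorm_bound) auto
    moreover have "onorm A \<ge> 0"
      using A by (intro onorm_pos_le) (simp add: bounded_extension_def)
    ultimately have "(onorm A)\<^sup>2 \<le> C"
      using C(1) by (metis power_mono real_sqrt_pow2)
    then show ?thesis
      using bounded_extension_necessary(3)[OF A] C(2) by simp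
  qed
  have "\<exists>A. bounded_extension \<sigma> A"
    if "\<forall>j. (\<lambda>k. (cmod (symbol_matrix \<sigma> j k))\<^sup>2) summable_on UNIV"
      "\<forall>n\<ge>1. mat_pow_defined (gram_matrix \<sigma>) n" "tau_sup \<sigma> < \<infinity>"
    using bounded_extension_from_growth fin[OF that(3)] that(1,2)
    unfolding square_summable_def by (metis order_refl)
  moreover have "(\<forall>j. (\<lambda>k. (cmod (symbol_matrix \<sigma> j k))\<^sup>2) summable_on UNIV) \<and>
      (\<forall>n\<ge>1. mat_pow_defined (gram_matrix \<sigma>) n) \<and> tau_sup \<sigma> < \<infinity>" if "bounded_extension \<sigma> A" for A
    using bounded_extension_necessary(1)[OF that] bounded_extension_necessary(2)[OF that] finite_sup[OF that]
    unfolding square_summable_def by blast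
  ultimately show ?thesis
    using eq gram_defined by blast
qed

end
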